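(* Let $n\to\infty$ be an integer and $q$ a prime power (bounded or not). Let $X$ be the random subset of $\mathbb{F}_q^n$ containing each element independently with probability $\theta$. Let $m$ be a bounded positive integer. Then the event $\Gamma$ that $X$ contains (entirely) some $m$-flat of $\mathbb{F}_q^n$ has threshold function $q^{-n(m+1)q^{-m}}$. Moreover, if $q\to\infty$, this threshold is sharp.
   Context: An $m$-flat in $\mathbb{F}_q^n$ is a translate of an $m$-dimensional linear subspace. A function $t$ is a threshold function for $\Gamma$ if $\Pr[\Gamma]\to0$ whenever $\theta=o(t)$ and $\Pr[\Gamma]\to1$ whenever $\theta=\omega(t)$; it is a sharp threshold if for every fixed $\epsilon>0$, $\Pr[\Gamma]\to0$ when $\theta\le(1-\epsilon)t$ and $\Pr[\Gamma]\to1$ when $\theta\ge(1+\epsilon)t$. *)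

theory Defs
  imports
    "HOL-Probability.Probability"
    "HOL-Library.Landau_Symbols"
    "HOL-Number_Theory.Prime_Powers"
    "HOL-Algebra.AbelCoset"
    "Jordan_Normal_Form.Missing_VectorSpace"
begin

text \<open>The space \<open>F\<^sup>n\<close>. The dimension and the field both vary along the sequences considered, so
  \<open>F\<close> is a locale-style field and a vector is an extensional function on \<open>{..<n}\<close>. The ring
  fields \<open>mult\<close> and \<open>one\<close> of the module record play no role.\<close>

definition coord_space :: "('a, 'b) ring_scheme \<Rightarrow> nat \<Rightarrow> ('a, nat \<Rightarrow> 'a) module" where
  "coord_space F n =
    \<lparr>carrier = {..<n} \<rightarrow>\<^sub>E carrier F, mult = undefined, one = undefined,
     ring.zero = (\<lambda>i\<in>{..<n}. \<zero>\<^bsub>F\<^esub>),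
     ring.add = (\<lambda>u v. \<lambda>i\<in>{..<n}. u i \<oplus>\<^bsub>F\<^esub> v i),
     smult = (\<lambda>c v. \<lambda>i\<in>{..<n}. c \<otimes>\<^bsub>F\<^esub> v i)\<rparr>"

lemma vectorspace_coord_space:
  assumes "field F"
  shows "vectorspace F (coord_space F n)"
proof -
  interpret field F by (rule assms)
  have "abelian_group (coord_space F n)"
  proof (rule abelian_groupI)
    fix x assume "x \<in> carrier (coord_space F n)"
    then show "\<exists>y\<in>carrier (coord_space F n).
        y \<oplus>\<^bsub>coord_space F n\<^esub> x = \<zero>\<^bsub>coord_space F n\<^esub>"
      by (intro bexI[of _ "\<lambda>i\<in>{..<n}. \<ominus>\<^bsub>F\<^esub> x i"])
        (auto simp: coord_space_def PiE_iff l_neg)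
  qed (auto simp: coord_space_def PiE_iff extensional_def Ball_def fun_eq_iff a_ac)
  then have "module F (coord_space F n)"
    by (intro moduleI is_cring)
      (auto simp: coord_space_def PiE_iff extensional_def Ball_def fun_eq_iff m_assoc l_distr r_distr)
  then show ?thesis
    by (intro vectorspace.intro assms)
qed

definition flats :: "('a, 'b) ring_scheme \<Rightarrow> nat \<Rightarrow> nat \<Rightarrow> (nat \<Rightarrow> 'a) set set" where
  "flats F n m =
    {a <+\<^bsub>coord_space F n\<^esub> U | a U. a \<in> carrier (coord_space F n) \<and>
       VectorSpace.subspace F U (coord_space F n) \<and>
       vectorspace.dim F ((coord_space F n)\<lparr>carrier := U\<rparr>) = m}"

definition random_subset :: "'a set \<Rightarrow> real \<Rightarrow> 'a set pmf" where
  "random_subset S \<theta> =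
    map_pmf (\<lambda>f. {x \<in> S. f x}) (Pi_pmf S False (\<lambda>_. bernoulli_pmf \<theta>))"

definition prob_contains_flat :: "('a, 'b) ring_scheme \<Rightarrow> nat \<Rightarrow> nat \<Rightarrow> real \<Rightarrow> real" where
  "prob_contains_flat F n m \<theta> =
    measure_pmf.prob (random_subset (carrier (coord_space F n)) \<theta>)
      {A. \<exists>L \<in> flats F n m. L \<subseteq> A}"

text \<open>Below, \<open>P n \<theta>\<close> is the probability of the \<open>n\<close>-th event when elements are chosen with
  probability \<open>\<theta>\<close>; only sequences \<open>\<theta>\<close> with values in \<open>{0..1}\<close> are meaningful.\<close>

definition threshold_function :: "(nat \<Rightarrow> real \<Rightarrow> real) \<Rightarrow> (nat \<Rightarrow> real) \<Rightarrow> bool" where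
  "threshold_function P t \<longleftrightarrow>
    (\<forall>\<theta>. (\<forall>n. \<theta> n \<in> {0..1}) \<longrightarrow>
      (\<theta> \<in> o(t) \<longrightarrow> (\<lambda>n. P n (\<theta> n)) \<longlonglongrightarrow> 0) \<and>
      (\<theta> \<in> \<omega>(t) \<longrightarrow> (\<lambda>n. P n (\<theta> n)) \<longlonglongrightarrow> 1))"

definition sharp_threshold :: "(nat \<Rightarrow> real \<Rightarrow> real) \<Rightarrow> (nat \<Rightarrow> real) \<Rightarrow> bool" where
  "sharp_threshold P t \<longleftrightarrow>
    (\<forall>\<epsilon>>0. \<forall>\<theta>. (\<forall>n. \<theta> n \<in> {0..1}) \<longrightarrow>
      ((\<forall>\<^sub>F n in sequentially. \<theta> n \<le> (1 - \<epsilon>) * t n) \<longrightarrow> (\<lambda>n. P n (\<theta> n)) \<longlonglongrightarrow> 0) \<and>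
      ((\<forall>\<^sub>F n in sequentially. \<theta> n \<ge> (1 + \<epsilon>) * t n) \<longrightarrow> (\<lambda>n. P n (\<theta> n)) \<longlonglongrightarrow> 1))"

end

theory Submission
  imports Defs "HOL-Real_Asymp.Real_Asymp"
begin

text \<open>There are at most \<open>q\<^bsup>n(m+1)\<^esup>\<close> flats, each of size \<open>q\<^sup>m\<close>, so by the union bound the probability is at
  most \<open>(\<theta> / t)\<close> to the power \<open>q\<^sup>m\<close>. For the opposite direction the second moment method is applied
  only to the flats that are graphs of affine maps from the first \<open>m\<close> to the last \<open>n - m\<close>
  coordinates. There are exactly \<open>q\<^bsup>(n-m)(m+1)\<^esup>\<close> of these, and two of them meet in at most \<open>q\<^sup>j\<close>
  points, where \<open>j\<close> is the dimension of the kernel of the difference of the linear parts. A linear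
  map with a kernel of dimension \<open>j\<close> is determined by a basis of the kernel and by \<open>n - m\<close> vectors
  of its orthogonal complement, which has \<open>q\<^bsup>m-j\<^esup>\<close> elements. This bounds the contribution of each
  \<open>j\<close> to the normalised second moment.\<close>

section \<open>Finite vector spaces\<close>

text \<open>Passing from all flats to graphs costs at most a factor q^(m(m+1)) in the count, which
  is independent of n. With \<theta> = c t and m bounded by M, the term j = m of the normalised
  second moment is therefore at most q^O(M^2) times (1/c)^(q^m). It is small if c tends to infinity,
  and also if c > 1 is fixed and q tends to infinity, which is the source of sharpness. For j < m
  the exponent of q is n((m+1)/q^(m-j) - (j+1)) plus a quantity free of n, so the bracket has to be
  negative and bounded away from 0. The first claim assumes neither that q is bounded nor that it
  diverges, and m may vary with n, so the estimates must be uniform in q and their constants may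
  depend on M only.\<close>

context vectorspace begin

text \<open>Coordinates with respect to a basis put the carrier in bijection with the functions from
  the basis to the field. Dimensions can thus be read off from cardinalities, which is how they are
  determined later.\<close>

lemma card_eq_power_dim:
  assumes "finite (carrier V)"
  shows "card (carrier V) = order K ^ dim"
proof -
  have "span (carrier V) = carrier V"
    using in_own_span span_is_subset2 by blast
  then have "fin_dim"
    unfolding fin_dim_def using assms by blast
  then obtain B where B: "finite B" "basis B"
    using finite_basis_exists by blast
  then have BV: "B \<subseteq> carrier V"
    by (simp add: basis_def)
  have "bij_betw (\<lambda>a. lincomb a B) (B \<rightarrow>\<^sub>E carrier K) (carrier V)"
    unfolding bij_betw_def
  proof (intro conjI inj_onI equalityI subsetI)
    fix a b
    assume ab: "a \<in> B \<rightarrow>\<^sub>E carrier K" "b \<in> B \<rightarrow>\<^sub>E carrier K" "lincomb a B = lincomb b B"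
    then have "lincomb a B \<in> carrier V"
      using BV by (intro lincomb_closed) auto
    with ab show "a = b"
      using basis_criterion[OF B(1) BV] B(2) by metis
  next
    fix v assume "v \<in> (\<lambda>a. lincomb a B) ` (B \<rightarrow>\<^sub>E carrier K)"
    then show "v \<in> carrier V"
      using BV by (auto intro!: lincomb_closed)
  next
    fix v assume "v \<in> carrier V"
    then show "v \<in> (\<lambda>a. lincomb a B) ` (B \<rightarrow>\<^sub>E carrier K)"
      using basis_criterion[OF B(1) BV] B(2) by (metis imageI)
  qed
  then have "card (carrier V) = card (B \<rightarrow>\<^sub>E carrier K)"
    by (metis bij_betw_same_card)
  then show ?thesis
    using B by (simp add: card_PiE order_def dim_basis)
qed

lemma subspace_card:
  assumes "subspace K U V" "finite U"
  shows "card U = order K ^ vectorspace.dim K (vs U)"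
  using vectorspace.card_eq_power_dim[OF subspace_is_vs[OF assms(1)]] assms(2) by simp

text \<open>The span is taken in the ambient space, so that subspaces are determined by subsets of
  one fixed carrier. This turns counting subspaces into counting subsets.\<close>

lemma subspace_obtain_basis:
  assumes "subspace K U V" "finite U"
  obtains B where "finite B" "B \<subseteq> U" "card B = vectorspace.dim K (vs U)" "span B = U"
proof -
  interpret U: vectorspace K "vs U"
    by (rule subspace_is_vs[OF assms(1)])
  have "U.span U = U"
    using U.in_own_span[of U] U.span_is_subset2[of U] by auto
  then have "U.fin_dim"
    unfolding U.fin_dim_def using assms(2) by auto
  then obtain B where B: "finite B" "U.basis B"
    using U.finite_basis_exists by blast
  then have "B \<subseteq> U" "U.span B = U"
    by (auto simp: U.basis_def)
  moreover have "U.span B = span B"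
    using span_li_not_depend(1)[of B U] \<open>B \<subseteq> U\<close> assms(1) by simp
  ultimately show ?thesis
    using that B U.dim_basis by metis
qed

text \<open>Scaling \<open>v\<close> gives a vector \<open>e\<close> with \<phi> e = 1. Every w is
  then uniquely an element of the kernel plus a multiple of \<open>e\<close>, the coefficient being
  \<phi> w.\<close>

lemma card_kernel_functional:
  assumes closed: "\<And>v. v \<in> carrier V \<Longrightarrow> \<phi> v \<in> carrier K"
    and add: "\<And>v w. \<lbrakk>v \<in> carrier V; w \<in> carrier V\<rbrakk> \<Longrightarrow> \<phi> (v \<oplus>\<^bsub>V\<^esub> w) = \<phi> v \<oplus>\<^bsub>K\<^esub> \<phi> w"
    and smult: "\<And>c v. \<lbrakk>c \<in> carrier K; v \<in> carrier V\<rbrakk> \<Longrightarrow> \<phi> (c \<odot>\<^bsub>V\<^esub> v) = c \<otimes>\<^bsub>K\<^esub> \<phi> v"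
    and nz: "v \<in> carrier V" "\<phi> v \<noteq> \<zero>\<^bsub>K\<^esub>"
  shows "card (carrier V) = order K * card {v \<in> carrier V. \<phi> v = \<zero>\<^bsub>K\<^esub>}"
proof -
  define e where "e = inv\<^bsub>K\<^esub> (\<phi> v) \<odot>\<^bsub>V\<^esub> v"
  have inv: "inv\<^bsub>K\<^esub> (\<phi> v) \<in> carrier K" "inv\<^bsub>K\<^esub> (\<phi> v) \<otimes>\<^bsub>K\<^esub> \<phi> v = \<one>\<^bsub>K\<^esub>"
    using nz closed[of v] by (auto simp: field_Units)
  then have e: "e \<in> carrier V" "\<phi> e = \<one>\<^bsub>K\<^esub>"
    using nz by (auto simp: e_def smult)
  have \<phi>: "\<phi> (u \<oplus>\<^bsub>V\<^esub> c \<odot>\<^bsub>V\<^esub> e) = \<phi> u \<oplus>\<^bsub>K\<^esub> c"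
    if "u \<in> carrier V" "c \<in> carrier K" for u c
    using that e by (simp add: add smult)
  have "bij_betw (\<lambda>(c, u). u \<oplus>\<^bsub>V\<^esub> c \<odot>\<^bsub>V\<^esub> e)
      (carrier K \<times> {v \<in> carrier V. \<phi> v = \<zero>\<^bsub>K\<^esub>}) (carrier V)"
  proof (rule bij_betw_byWitness[where f' = "\<lambda>w. (\<phi> w, w \<oplus>\<^bsub>V\<^esub> (\<ominus>\<^bsub>K\<^esub> \<phi> w) \<odot>\<^bsub>V\<^esub> e)"], goal_cases)
    case 1
    then show ?case
      using e by (auto simp: \<phi> smult_l_minus M.a_assoc M.r_neg)
  next
    case 2
    then show ?case
      using e closed by (auto simp: smult_l_minus M.a_assoc M.l_neg)
  next
    case 3
    then show ?case
      using e by auto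
  next
    case 4
    then show ?case
      using e closed by (auto simp: \<phi> R.r_neg)
  qed
  then show ?thesis
    by (simp add: order_def card_cartesian_product flip: bij_betw_same_card)
qed

end

section \<open>The dot product on coordinate spaces\<close>

text \<open>Only the values on \<open>{..<m}\<close> are read. A vector of the n-dimensional space
  with m \<le> n can therefore be inserted directly, standing for its first m coordinates.\<close>

definition dot :: "('a, 'b) ring_scheme \<Rightarrow> nat \<Rightarrow> (nat \<Rightarrow> 'a) \<Rightarrow> (nat \<Rightarrow> 'a) \<Rightarrow> 'a" where
  "dot F m a x = (\<Oplus>\<^bsub>F\<^esub>k\<in>{..<m}. a k \<otimes>\<^bsub>F\<^esub> x k)"

lemma carrier_coord_space: "carrier (coord_space F n) = {..<n} \<rightarrow>\<^sub>E carrier F"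
  by (simp add: coord_space_def)

lemma add_coord_space: "u \<oplus>\<^bsub>coord_space F n\<^esub> v = (\<lambda>i\<in>{..<n}. u i \<oplus>\<^bsub>F\<^esub> v i)"
  by (simp add: coord_space_def)

lemma smult_coord_space: "c \<odot>\<^bsub>coord_space F n\<^esub> v = (\<lambda>i\<in>{..<n}. c \<otimes>\<^bsub>F\<^esub> v i)"
  by (simp add: coord_space_def)

lemma zero_coord_space: "\<zero>\<^bsub>coord_space F n\<^esub> = (\<lambda>i\<in>{..<n}. \<zero>\<^bsub>F\<^esub>)"
  by (simp add: coord_space_def)

lemmas coord_space_simps =
  carrier_coord_space add_coord_space smult_coord_space zero_coord_space

lemma card_carrier_coord_space: "card (carrier (coord_space F n)) = order F ^ n"
  by (simp add: carrier_coord_space card_PiE order_def)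

lemma finite_carrier_coord_space:
  "finite (carrier F) \<Longrightarrow> finite (carrier (coord_space F n))"
  by (simp add: carrier_coord_space finite_PiE)

context cring begin

lemma dot_closed [simp]:
  "\<lbrakk>a \<in> {..<m} \<rightarrow> carrier R; x \<in> {..<m} \<rightarrow> carrier R\<rbrakk> \<Longrightarrow> dot R m a x \<in> carrier R"
  unfolding dot_def by (rule finsum_closed) auto

lemma dot_commute:
  "\<lbrakk>a \<in> {..<m} \<rightarrow> carrier R; x \<in> {..<m} \<rightarrow> carrier R\<rbrakk> \<Longrightarrow> dot R m a x = dot R m x a"
  unfolding dot_def by (intro finsum_cong') (auto simp: Pi_iff m_comm)

text \<open>The restriction to \<open>{..<n}\<close> with m \<le> n makes the rule fit the addition
  of the n-dimensional space, in which the graphs live, as well as that of the m-dimensional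
  one.\<close>

lemma dot_add_right:
  assumes "a \<in> {..<m} \<rightarrow> carrier R" "x \<in> {..<m} \<rightarrow> carrier R" "y \<in> {..<m} \<rightarrow> carrier R" "m \<le> n"
  shows "dot R m a (\<lambda>i\<in>{..<n}. x i \<oplus> y i) = dot R m a x \<oplus> dot R m a y"
proof -
  have "dot R m a (\<lambda>i\<in>{..<n}. x i \<oplus> y i) = (\<Oplus>k\<in>{..<m}. a k \<otimes> x k \<oplus> a k \<otimes> y k)"
    unfolding dot_def using assms by (intro finsum_cong') (auto simp: Pi_iff r_distr)
  also have "\<dots> = dot R m a x \<oplus> dot R m a y"
    unfolding dot_def using assms by (intro finsum_addf) auto
  finally show ?thesis .
qed

lemma dot_smult_right:
  assumes "a \<in> {..<m} \<rightarrow> carrier R" "x \<in> {..<m} \<rightarrow> carrier R" "c \<in> carrier R" "m \<le> n"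
  shows "dot R m a (\<lambda>i\<in>{..<n}. c \<otimes> x i) = c \<otimes> dot R m a x"
  unfolding dot_def using assms
  by (subst finsum_rdistr) (auto simp: Pi_iff m_lcomm intro!: finsum_cong')

lemma dot_zero_right:
  assumes "a \<in> {..<m} \<rightarrow> carrier R" "m \<le> n"
  shows "dot R m a (\<lambda>i\<in>{..<n}. \<zero>) = \<zero>"
proof -
  have "dot R m a (\<lambda>i\<in>{..<n}. \<zero>) = (\<Oplus>k\<in>{..<m}. \<zero>)"
    unfolding dot_def using assms by (intro finsum_cong') (auto simp: Pi_iff)
  then show ?thesis by simp
qed

lemma dot_unit_vector:
  assumes "x \<in> {..<m} \<rightarrow> carrier R" "k < m"
  shows "dot R m (\<lambda>i\<in>{..<m}. if k = i then \<one> else \<zero>) x = x k"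
proof -
  have "dot R m (\<lambda>i\<in>{..<m}. if k = i then \<one> else \<zero>) x = (\<Oplus>i\<in>{..<m}. if k = i then x i else \<zero>)"
    unfolding dot_def using assms by (intro finsum_cong') (auto simp: Pi_iff)
  also have "\<dots> = x k"
    using assms by (subst finsum_singleton) (auto simp: Pi_iff)
  finally show ?thesis .
qed

end

context field begin

lemma card_hyperplane:
  assumes "subspace R U (coord_space R m)" "a \<in> carrier (coord_space R m)"
    and "z \<in> U" "dot R m a z \<noteq> \<zero>"
  shows "card U = order R * card {z \<in> U. dot R m a z = \<zero>}"
proof -
  interpret V: vectorspace R "coord_space R m"
    by (rule vectorspace_coord_space) (rule field_axioms)
  interpret U: vectorspace R "V.vs U"
    by (rule V.subspace_is_vs) fact
  have UV: "U \<subseteq> carrier (coord_space R m)"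
    using assms(1) by (simp add: subspace_def submodule_def)
  have "card (carrier (V.vs U)) = order R * card {z \<in> carrier (V.vs U). dot R m a z = \<zero>}"
  proof (rule U.card_kernel_functional[where v = z])
    fix u assume "u \<in> carrier (V.vs U)"
    then show "dot R m a u \<in> carrier R"
      using assms(2) UV by (auto simp: carrier_coord_space PiE_iff)
  next
    fix u v assume "u \<in> carrier (V.vs U)" "v \<in> carrier (V.vs U)"
    then have "u \<in> carrier (coord_space R m)" "v \<in> carrier (coord_space R m)"
      using UV by auto
    then show "dot R m a (u \<oplus>\<^bsub>V.vs U\<^esub> v) = dot R m a u \<oplus> dot R m a v"
      using assms(2) by (simp add: coord_space_simps PiE_def dot_add_right)
  next
    fix c u assume "c \<in> carrier R" "u \<in> carrier (V.vs U)"
    moreover then have "u \<in> carrier (coord_space R m)"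
      using UV by auto
    ultimately show "dot R m a (c \<odot>\<^bsub>V.vs U\<^esub> u) = c \<otimes> dot R m a u"
      using assms(2) by (simp add: coord_space_simps PiE_def dot_smult_right)
  qed (use assms in auto)
  then show ?thesis by simp
qed

lemma order_ge_2:
  assumes "finite (carrier R)"
  shows "order R \<ge> 2"
proof -
  have "card {\<zero>, \<one>} \<le> card (carrier R)"
    using assms by (intro card_mono) auto
  then show ?thesis by (simp add: order_def)
qed

text \<open>Over a finite field \<open>U\<close> and \<open>perp m U\<close> may share nonzero
  vectors, so the complement is controlled through its size and not through a direct sum.\<close>

definition perp :: "nat \<Rightarrow> (nat \<Rightarrow> 'a) set \<Rightarrow> (nat \<Rightarrow> 'a) set" where
  "perp m U = {a \<in> carrier (coord_space R m). \<forall>z\<in>U. dot R m a z = \<zero>}"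

text \<open>Both sides come from counting the pairs \<open>(a, z)\<close> with \<open>z \<in> U\<close> and \<open>a \<bullet> z = 0\<close>.\<close>

lemma card_mult_card_perp:
  assumes U: "subspace R U (coord_space R m)" and fin: "finite (carrier R)"
  shows "card U * card (perp m U) = order R ^ m"
proof -
  interpret V: vectorspace R "coord_space R m"
    by (rule vectorspace_coord_space) (rule field_axioms)
  let ?V = "carrier (coord_space R m)" and ?q = "order R"
  have finV: "finite ?V"
    using fin by (rule finite_carrier_coord_space)
  have UV: "U \<subseteq> ?V" and U0: "\<zero>\<^bsub>coord_space R m\<^esub> \<in> U"
    using U by (auto simp: subspace_def submodule_def)
  have finU: "finite U"
    using UV finV by (rule finite_subset)
  have PV: "perp m U \<subseteq> ?V"
    by (auto simp: perp_def)
  \<comment> \<open>The functional \<open>dot R m a\<close> on \<open>U\<close> is either zero or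
    has a kernel of index q. The factor \<open>?q\<close> on the left avoids division of natural
    numbers.\<close>
  have card_a: "?q * card {z \<in> U. dot R m a z = \<zero>} = (if a \<in> perp m U then ?q * card U else card U)"
    if a: "a \<in> ?V" for a
  proof (cases "a \<in> perp m U")
    case True
    then have "{z \<in> U. dot R m a z = \<zero>} = U"
      by (auto simp: perp_def)
    with True show ?thesis by simp
  next
    case False
    then obtain z where "z \<in> U" "dot R m a z \<noteq> \<zero>"
      using False a by (auto simp: perp_def)
    from card_hyperplane[OF U a this] False show ?thesis by simp
  qed
  \<comment> \<open>The same dichotomy with the roles exchanged. For nonzero \<open>z\<close> a unit
    vector at a nonzero coordinate shows that the functional does not vanish.\<close>
  have card_z: "?q * card {a \<in> ?V. dot R m a z = \<zero>} =
      (if z = \<zero>\<^bsub>coord_space R m\<^esub> then ?q * ?q ^ m else ?q ^ m)"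
    if "z \<in> U" for z
  proof (cases "z = \<zero>\<^bsub>coord_space R m\<^esub>")
    case True
    then have "{a \<in> ?V. dot R m a z = \<zero>} = ?V"
      by (auto simp: coord_space_simps PiE_def dot_zero_right)
    with True show ?thesis by (simp add: card_carrier_coord_space)
  next
    case False
    have z: "z \<in> ?V" using that UV by auto
    have "z = \<zero>\<^bsub>coord_space R m\<^esub>" if "\<And>k. k < m \<Longrightarrow> z k = \<zero>"
      using z that by (auto simp: coord_space_simps PiE_iff extensional_def)
    then obtain k where k: "k < m" "z k \<noteq> \<zero>"
      using False by blast
    let ?e = "\<lambda>i\<in>{..<m}. if k = i then \<one> else \<zero>"
    have e: "?e \<in> ?V" by (auto simp: carrier_coord_space)
    have "dot R m z ?e = z k"
      using z e k by (subst dot_commute) (auto simp: carrier_coord_space PiE_def dot_unit_vector)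
    moreover have "subspace R ?V (coord_space R m)"
      by (auto simp: subspace_def submodule_def V.module_axioms V.vectorspace_axioms)
    ultimately have "card ?V = ?q * card {a \<in> ?V. dot R m z a = \<zero>}"
      using card_hyperplane[of ?V m z ?e] z e k by auto
    moreover have "{a \<in> ?V. dot R m z a = \<zero>} = {a \<in> ?V. dot R m a z = \<zero>}"
      using z dot_commute by (auto simp: carrier_coord_space PiE_def)
    ultimately show ?thesis
      using False by (simp add: card_carrier_coord_space)
  qed
  have "?q * (\<Sum>a\<in>?V. card {z \<in> U. dot R m a z = \<zero>}) =
      ?q * (\<Sum>z\<in>U. card {a \<in> ?V. dot R m a z = \<zero>})"
    using sum_multicount_gen[OF finV finU, of "\<lambda>a z. dot R m a z = \<zero>"
        "\<lambda>z. card {a \<in> ?V. dot R m a z = \<zero>}"] by simp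
  moreover have "?q * (\<Sum>a\<in>?V. card {z \<in> U. dot R m a z = \<zero>}) =
      card (perp m U) * (?q * card U) + card (?V - perp m U) * card U"
    using finV PV
    by (simp add: sum_distrib_left card_a sum.If_cases Int_absorb1 Diff_eq cong: sum.cong)
  moreover have "?q * (\<Sum>z\<in>U. card {a \<in> ?V. dot R m a z = \<zero>}) =
      ?q * ?q ^ m + card (U - {\<zero>\<^bsub>coord_space R m\<^esub>}) * ?q ^ m"
  proof -
    have "?q * (\<Sum>z\<in>U. card {a \<in> ?V. dot R m a z = \<zero>}) =
        (\<Sum>z\<in>U. if z = \<zero>\<^bsub>coord_space R m\<^esub> then ?q * ?q ^ m else ?q ^ m)"
      by (simp add: sum_distrib_left card_z cong: sum.cong)
    also have "\<dots> = ?q * ?q ^ m + (\<Sum>z\<in>U - {\<zero>\<^bsub>coord_space R m\<^esub>}. ?q ^ m)"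
      by (subst sum.remove[OF finU U0]) (auto intro!: sum.cong)
    finally show ?thesis by simp
  qed
  ultimately have eq: "card (perp m U) * (?q * card U) + card (?V - perp m U) * card U =
      ?q * ?q ^ m + card (U - {\<zero>\<^bsub>coord_space R m\<^esub>}) * ?q ^ m"
    by simp
  \<comment> \<open>In the integers the differences expand. With p = card (perp m U) and u = card U
    the double count becomes (q - 1) u p = (q - 1) q^m.\<close>
  have "int (card (?V - perp m U)) = int ?q ^ m - int (card (perp m U))"
    using PV finV card_mono[OF finV PV]
    by (simp add: card_Diff_subset finite_subset card_carrier_coord_space of_nat_diff)
  moreover have "int (card (U - {\<zero>\<^bsub>coord_space R m\<^esub>})) = int (card U) - 1"
    using finU U0 by (metis card.remove card_Diff_singleton add_diff_cancel_left' of_nat_Suc)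
  ultimately have "int (card (perp m U)) * (int ?q * int (card U)) +
      (int ?q ^ m - int (card (perp m U))) * int (card U) =
      int ?q * int ?q ^ m + (int (card U) - 1) * int ?q ^ m"
    using arg_cong[OF eq, of int] by simp
  then have "(int ?q - 1) * (int (card U) * int (card (perp m U))) = (int ?q - 1) * int ?q ^ m"
    by (simp add: algebra_simps)
  then have "int (card U) * int (card (perp m U)) = int ?q ^ m"
    using order_ge_2[OF fin] by simp
  then show ?thesis
    by (metis of_nat_mult of_nat_power of_nat_eq_iff)
qed

end

section \<open>Random subsets\<close>

lemma finite_set_pmf_random_subset:
  assumes "finite S"
  shows "finite (set_pmf (random_subset S \<theta>))"
proof -
  have "set_pmf (random_subset S \<theta>) \<subseteq> Pow S"
    by (auto simp: random_subset_def)
  then show ?thesis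
    using assms by (simp add: finite_subset)
qed

lemma prob_superset_random_subset:
  assumes "finite S" "A \<subseteq> S" "\<theta> \<in> {0..1}"
  shows "measure_pmf.prob (random_subset S \<theta>) {X. A \<subseteq> X} = \<theta> ^ card A"
proof -
  have "measure_pmf.prob (random_subset S \<theta>) {X. A \<subseteq> X} =
      measure_pmf.prob (Pi_pmf S False (\<lambda>_. bernoulli_pmf \<theta>))
        (Pi S (\<lambda>x. if x \<in> A then {True} else UNIV))"
    unfolding random_subset_def measure_map_pmf using assms(2)
    by (intro arg_cong[where f = "measure_pmf.prob _"]) (auto simp: Pi_iff split: if_splits)
  also have "\<dots> = (\<Prod>x\<in>S. measure_pmf.prob (bernoulli_pmf \<theta>) (if x \<in> A then {True} else UNIV))"
    by (rule measure_Pi_pmf_Pi) fact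
  also have "\<dots> = (\<Prod>x\<in>S. if x \<in> A then \<theta> else 1)"
    using assms(3) by (intro prod.cong) (auto simp: measure_pmf_single)
  also have "\<dots> = \<theta> ^ card A"
    using assms by (simp add: prod.If_cases Int_absorb1)
  finally show ?thesis .
qed

lemma prob_random_subset_union_bound:
  assumes "finite S" "\<theta> \<in> {0..1}" "finite \<L>"
    and "\<And>L. L \<in> \<L> \<Longrightarrow> L \<subseteq> S" "\<And>L. L \<in> \<L> \<Longrightarrow> card L = k"
  shows "measure_pmf.prob (random_subset S \<theta>) {X. \<exists>L\<in>\<L>. L \<subseteq> X} \<le> real (card \<L>) * \<theta> ^ k"
proof -
  have "measure_pmf.prob (random_subset S \<theta>) {X. \<exists>L\<in>\<L>. L \<subseteq> X} =
      measure_pmf.prob (random_subset S \<theta>) (\<Union>L\<in>\<L>. {X. L \<subseteq> X})"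
    by (rule arg_cong[where f = "measure_pmf.prob _"]) auto
  also have "\<dots> \<le> (\<Sum>L\<in>\<L>. measure_pmf.prob (random_subset S \<theta>) {X. L \<subseteq> X})"
    using assms(3) by (intro measure_pmf.finite_measure_subadditive_finite) auto
  also have "\<dots> = real (card \<L>) * \<theta> ^ k"
    using assms by (simp add: prob_superset_random_subset)
  finally show ?thesis .
qed

text \<open>The indicator of \<open>Y > 0\<close> dominates \<open>2 s Y - s\<^sup>2 Y\<^sup>2\<close>, where \<open>Y\<close> counts the indices \<open>i\<close> with
  \<open>L i \<subseteq> X\<close>. Taking expectations with \<open>s\<close> the reciprocal of \<open>R\<close> times the mean of \<open>Y\<close> gives the
  bound.\<close>

lemma prob_random_subset_second_moment:
  assumes S: "finite S" and \<theta>: "0 < \<theta>" "\<theta> \<le> 1" and I: "finite I" "I \<noteq> {}"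
    and L: "\<And>i. i \<in> I \<Longrightarrow> L i \<subseteq> S" "\<And>i. i \<in> I \<Longrightarrow> card (L i) = k"
    and R: "\<And>i. i \<in> I \<Longrightarrow> (\<Sum>j\<in>I. (1 / \<theta>) ^ card (L i \<inter> L j)) \<le> R * real (card I)"
    and R0: "R > 0"
  shows "1 / R \<le> measure_pmf.prob (random_subset S \<theta>) {X. \<exists>i\<in>I. L i \<subseteq> X}"
proof -
  let ?p = "random_subset S \<theta>"
  note fin = finite_set_pmf_random_subset[OF S, of \<theta>]
  have int: "integrable (measure_pmf ?p) f" for f :: "'a set \<Rightarrow> real"
    using fin by (rule integrable_measure_pmf_finite)
  define Y where "Y X = (\<Sum>i\<in>I. indicator {X. L i \<subseteq> X} X :: real)" for X
  define \<mu> where "\<mu> = real (card I) * \<theta> ^ k"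
  define s where "s = 1 / (R * \<mu>)"
  have \<mu>0: "\<mu> > 0"
    using I \<theta> by (simp add: \<mu>_def card_gt_0_iff)
  have EY: "measure_pmf.expectation ?p Y = \<mu>"
    unfolding Y_def[abs_def] using S L \<theta> by (simp add: \<mu>_def int prob_superset_random_subset)
  have prob: "measure_pmf.prob ?p {X. L i \<union> L j \<subseteq> X} = \<theta> ^ card (L i \<union> L j)"
    if "i \<in> I" "j \<in> I" for i j
    using S L(1) \<theta> that by (intro prob_superset_random_subset) auto
  have "measure_pmf.expectation ?p (\<lambda>X. (Y X)\<^sup>2) =
      measure_pmf.expectation ?p (\<lambda>X. \<Sum>i\<in>I. \<Sum>j\<in>I. indicator {X. L i \<union> L j \<subseteq> X} X)"
    by (auto simp: Y_def power2_eq_square sum_product indicator_def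
        intro!: Bochner_Integration.integral_cong sum.cong)
  also have "\<dots> = (\<Sum>i\<in>I. \<Sum>j\<in>I. \<theta> ^ card (L i \<union> L j))"
    by (simp add: int prob del: Un_subset_iff le_sup_iff sup.bounded_iff)
  \<comment> \<open>The union has 2k points minus those of the intersection. Powers of 1/\<theta>
    express the negative exponent, so that the hypothesis on intersections applies.\<close>
  also have "\<dots> = (\<Sum>i\<in>I. \<Sum>j\<in>I. \<theta> ^ (2 * k) * (1 / \<theta>) ^ card (L i \<inter> L j))"
  proof (intro sum.cong refl)
    fix i j assume ij: "i \<in> I" "j \<in> I"
    then have "finite (L i)" "finite (L j)"
      using S L(1) by (meson finite_subset)+
    then have "card (L i \<union> L j) + card (L i \<inter> L j) = 2 * k"
      using card_Un_Int[of "L i" "L j"] L(2) ij by simp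
    then have "\<theta> ^ (2 * k) = \<theta> ^ card (L i \<union> L j) * \<theta> ^ card (L i \<inter> L j)"
      by (metis power_add)
    then show "\<theta> ^ card (L i \<union> L j) = \<theta> ^ (2 * k) * (1 / \<theta>) ^ card (L i \<inter> L j)"
      using \<theta> by (simp add: power_one_over)
  qed
  also have "\<dots> = (\<Sum>i\<in>I. \<theta> ^ (2 * k) * (\<Sum>j\<in>I. (1 / \<theta>) ^ card (L i \<inter> L j)))"
    by (simp add: sum_distrib_left)
  also have "\<dots> \<le> (\<Sum>i\<in>I. \<theta> ^ (2 * k) * (R * real (card I)))"
    using R \<theta> by (intro sum_mono mult_left_mono) auto
  also have "\<dots> = R * \<mu>\<^sup>2"
    by (simp add: \<mu>_def power2_eq_square power_add mult_2)
  finally have EY2: "measure_pmf.expectation ?p (\<lambda>X. (Y X)\<^sup>2) \<le> R * \<mu>\<^sup>2" .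
  have "1 / R = 2 * s * \<mu> - s\<^sup>2 * (R * \<mu>\<^sup>2)"
    using \<mu>0 R0 by (simp add: s_def field_simps power2_eq_square)
  also have "\<dots> \<le> 2 * s * measure_pmf.expectation ?p Y - s\<^sup>2 * measure_pmf.expectation ?p (\<lambda>X. (Y X)\<^sup>2)"
    using EY2 by (simp add: EY mult_left_mono)
  also have "\<dots> = measure_pmf.expectation ?p (\<lambda>X. 2 * s * Y X - s\<^sup>2 * (Y X)\<^sup>2)"
    by (simp add: int)
  also have "\<dots> \<le> measure_pmf.expectation ?p (indicator {X. \<exists>i\<in>I. L i \<subseteq> X})"
  proof (intro integral_mono int)
    fix X
    show "2 * s * Y X - s\<^sup>2 * (Y X)\<^sup>2 \<le> indicator {X. \<exists>i\<in>I. L i \<subseteq> X} X"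
    proof (cases "\<exists>i\<in>I. L i \<subseteq> X")
      case True
      have "0 \<le> (s * Y X - 1)\<^sup>2" by simp
      with True show ?thesis
        by (simp add: power2_eq_square algebra_simps)
    next
      case False
      then have "Y X = 0" by (simp add: Y_def)
      then show ?thesis by simp
    qed
  qed
  finally show ?thesis by simp
qed

section \<open>Graphs of affine maps\<close>

text \<open>This is the kernel of the matrix with rows \<open>D i\<close> for \<open>i\<close> in
  \<open>J\<close>.\<close>

definition common_kernel ::
    "('a, 'b) ring_scheme \<Rightarrow> nat \<Rightarrow> 'i set \<Rightarrow> ('i \<Rightarrow> nat \<Rightarrow> 'a) \<Rightarrow> (nat \<Rightarrow> 'a) set" where
  "common_kernel F m J D = {z \<in> carrier (coord_space F m). \<forall>i\<in>J. dot F m (D i) z = \<zero>\<^bsub>F\<^esub>}"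

text \<open>Rows are indexed by the coordinates in \<open>{m..<n}\<close> that they compute, so no
  index is shifted. Since \<open>dot F m\<close> reads only the first m coordinates, the graph is a
  system of equations on \<open>x\<close> itself.\<close>

definition graph_flat ::
    "('a, 'b) ring_scheme \<Rightarrow> nat \<Rightarrow> nat \<Rightarrow> (nat \<Rightarrow> nat \<Rightarrow> 'a) \<times> (nat \<Rightarrow> 'a) \<Rightarrow> (nat \<Rightarrow> 'a) set" where
  "graph_flat F n m = (\<lambda>(A, b). {x \<in> carrier (coord_space F n).
     \<forall>i\<in>{m..<n}. x i = dot F m (A i) x \<oplus>\<^bsub>F\<^esub> b i})"

text \<open>Extensional functions make a pair the same thing as its values, as the exact count and
  the injectivity of the later encoding require.\<close>

definition affine_maps ::
    "('a, 'b) ring_scheme \<Rightarrow> nat \<Rightarrow> nat \<Rightarrow> ((nat \<Rightarrow> nat \<Rightarrow> 'a) \<times> (nat \<Rightarrow> 'a)) set" where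
  "affine_maps F n m =
     ({m..<n} \<rightarrow>\<^sub>E carrier (coord_space F m)) \<times> ({m..<n} \<rightarrow>\<^sub>E carrier F)"

lemma card_affine_maps: "card (affine_maps F n m) = order F ^ ((m + 1) * (n - m))"
proof -
  have "(m + 1) * (n - m) = m * (n - m) + (n - m)"
    by simp
  then show ?thesis
    unfolding affine_maps_def
    by (simp only: card_cartesian_product card_PiE finite_atLeastLessThan prod_constant
        card_atLeastLessThan card_carrier_coord_space power_add power_mult)
      (simp add: order_def)
qed

lemma finite_affine_maps:
  "finite (carrier F) \<Longrightarrow> finite (affine_maps F n m)"
  by (simp add: affine_maps_def finite_PiE finite_carrier_coord_space)

lemma choose_le_power: "n choose k \<le> n ^ k"
  using binomial_le_pow[of k n] by (cases "k \<le> n") (auto simp: binomial_eq_0)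

context cring begin

lemma dot_cong:
  assumes "a \<in> {..<m} \<rightarrow> carrier R" "y \<in> {..<m} \<rightarrow> carrier R" "\<And>k. k < m \<Longrightarrow> x k = y k"
  shows "dot R m a x = dot R m a y"
  unfolding dot_def using assms by (intro finsum_cong') (auto simp: Pi_iff)

lemma dot_diff_right:
  assumes a: "a \<in> {..<m} \<rightarrow> carrier R" and x: "x \<in> {..<m} \<rightarrow> carrier R"
    and y: "y \<in> {..<m} \<rightarrow> carrier R"
  shows "dot R m a (\<lambda>i\<in>{..<m}. x i \<ominus> y i) = dot R m a x \<ominus> dot R m a y"
proof -
  let ?d = "\<lambda>i\<in>{..<m}. x i \<ominus> y i"
  have d: "?d \<in> {..<m} \<rightarrow> carrier R"
    using x y by (auto simp: Pi_iff)
  have "dot R m a x = dot R m a (\<lambda>i\<in>{..<m}. ?d i \<oplus> y i)"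
  proof (rule sym, rule dot_cong[OF a x])
    fix k assume "k < m"
    then have "x k \<in> carrier R" "y k \<in> carrier R"
      using x y by auto
    then show "(\<lambda>i\<in>{..<m}. ?d i \<oplus> y i) k = x k"
      using \<open>k < m\<close> by (simp add: a_minus_def a_assoc l_neg)
  qed
  also have "\<dots> = dot R m a ?d \<oplus> dot R m a y"
    by (rule dot_add_right[OF a d y]) simp
  finally show ?thesis
    using a d y by (simp add: a_minus_def a_assoc r_neg)
qed

lemma dot_diff_left:
  assumes a: "a \<in> {..<m} \<rightarrow> carrier R" and b: "b \<in> {..<m} \<rightarrow> carrier R"
    and x: "x \<in> {..<m} \<rightarrow> carrier R"
  shows "dot R m (\<lambda>i\<in>{..<m}. a i \<ominus> b i) x = dot R m a x \<ominus> dot R m b x"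
proof -
  have "(\<lambda>i\<in>{..<m}. a i \<ominus> b i) \<in> {..<m} \<rightarrow> carrier R"
    using a b by (auto simp: Pi_iff)
  then show ?thesis
    using assms dot_diff_right[OF x a b] by (simp add: dot_commute)
qed

end

section \<open>Counting matrices by the dimension of their kernel\<close>

context field begin

lemma subspace_coord_spaceI:
  assumes "U \<subseteq> carrier (coord_space R n)" "\<zero>\<^bsub>coord_space R n\<^esub> \<in> U"
    and "\<And>u v. \<lbrakk>u \<in> U; v \<in> U\<rbrakk> \<Longrightarrow> u \<oplus>\<^bsub>coord_space R n\<^esub> v \<in> U"
    and "\<And>c u. \<lbrakk>c \<in> carrier R; u \<in> U\<rbrakk> \<Longrightarrow> c \<odot>\<^bsub>coord_space R n\<^esub> u \<in> U"
  shows "subspace R U (coord_space R n)"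
  using assms vectorspace_coord_space[OF field_axioms, of n]
  by (auto simp: subspace_def submodule_def vectorspace_def)

lemma subspace_common_kernel:
  assumes "D \<in> J \<rightarrow> carrier (coord_space R m)"
  shows "subspace R (common_kernel R m J D) (coord_space R m)"
  using assms
  by (intro subspace_coord_spaceI)
    (auto simp: common_kernel_def coord_space_simps PiE_def Pi_iff dot_add_right dot_smult_right
      dot_zero_right)

lemma row_mem_perp_common_kernel:
  assumes "D \<in> J \<rightarrow> carrier (coord_space R m)" "i \<in> J"
  shows "D i \<in> perp m (common_kernel R m J D)"
  using assms by (auto simp: perp_def common_kernel_def)

text \<open>Every row of \<open>D\<close> lies in the orthogonal complement of the kernel, and the kernel is the span
  of \<open>j\<close> vectors.\<close>

lemma card_common_kernel_eq_le:
  assumes fin: "finite (carrier R)" and J: "finite J" and j: "j \<le> m"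
  shows "card {D \<in> J \<rightarrow>\<^sub>E carrier (coord_space R m). card (common_kernel R m J D) = order R ^ j} \<le>
    (order R ^ m) ^ j * (order R ^ (m - j)) ^ card J" (is "card ?S \<le> _")
proof -
  interpret V: vectorspace R "coord_space R m"
    by (rule vectorspace_coord_space) (rule field_axioms)
  let ?V = "carrier (coord_space R m)" and ?q = "order R"
  \<comment> \<open>The size of the complement is recorded in \<open>?B\<close> because it is the
    number of choices for each row.\<close>
  let ?B = "{B. B \<subseteq> ?V \<and> card B = j \<and> card (perp m (V.module.span B)) = ?q ^ (m - j)}"
  have q: "?q \<ge> 2" by (rule order_ge_2[OF fin])
  have finV: "finite ?V"
    using fin by (rule finite_carrier_coord_space)
  have finB: "finite ?B"
    by (rule finite_subset[of _ "Pow ?V"]) (use finV in auto)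
  have "?S \<subseteq> (\<Union>B\<in>?B. J \<rightarrow>\<^sub>E perp m (V.module.span B))"
  proof
    fix D assume "D \<in> ?S"
    then have D: "D \<in> J \<rightarrow>\<^sub>E ?V" and cK: "card (common_kernel R m J D) = ?q ^ j"
      by auto
    let ?K = "common_kernel R m J D"
    have K: "subspace R ?K (coord_space R m)"
      using D by (intro subspace_common_kernel) auto
    have KV: "?K \<subseteq> ?V"
      by (auto simp: common_kernel_def)
    then have finK: "finite ?K"
      using finV finite_subset by blast
    obtain B where B: "finite B" "B \<subseteq> ?K" "card B = vectorspace.dim R (V.vs ?K)"
        "V.module.span B = ?K"
      using V.subspace_obtain_basis[OF K finK] .
    have "?q ^ j = ?q ^ vectorspace.dim R (V.vs ?K)"
      using V.subspace_card[OF K finK] cK by simp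
    then have "card B = j"
      using q B(3) by simp
    have "?q ^ j * card (perp m ?K) = ?q ^ j * ?q ^ (m - j)"
      using card_mult_card_perp[OF K fin] cK j by (simp flip: power_add)
    then have "card (perp m ?K) = ?q ^ (m - j)"
      using q by simp
    moreover have "D \<in> J \<rightarrow>\<^sub>E perp m ?K"
      using D row_mem_perp_common_kernel[of D J m] by (auto simp: PiE_def)
    ultimately have 1: "card (perp m (V.module.span B)) = ?q ^ (m - j)"
        "D \<in> J \<rightarrow>\<^sub>E perp m (V.module.span B)"
      by (simp_all only: B(4))
    moreover have 2: "B \<subseteq> ?V"
      using B(2) KV by (rule subset_trans)
    ultimately show "D \<in> (\<Union>B\<in>?B. J \<rightarrow>\<^sub>E perp m (V.module.span B))"
      using \<open>card B = j\<close> by blast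
  qed
  moreover have "finite (\<Union>B\<in>?B. J \<rightarrow>\<^sub>E perp m (V.module.span B))"
  proof -
    have "finite (perp m U)" for U
      by (rule finite_subset[OF _ finV]) (auto simp: perp_def)
    then show ?thesis
      using finB J by (auto intro!: finite_PiE)
  qed
  ultimately have "card ?S \<le> card (\<Union>B\<in>?B. J \<rightarrow>\<^sub>E perp m (V.module.span B))"
    by (intro card_mono)
  also have "\<dots> \<le> (\<Sum>B\<in>?B. card (J \<rightarrow>\<^sub>E perp m (V.module.span B)))"
    using finB by (rule card_UN_le)
  also have "\<dots> = card ?B * (?q ^ (m - j)) ^ card J"
    using J by (simp add: card_PiE)
  \<comment> \<open>Counting all j-element subsets is generous, but the resulting factor q^(mj) does
    not involve the number of rows and hence not n.\<close>
  also have "card ?B \<le> card {B. B \<subseteq> ?V \<and> card B = j}"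
    by (rule card_mono[OF finite_subset[of _ "Pow ?V"]]) (use finV in auto)
  also have "\<dots> = ?q ^ m choose j"
    using n_subsets[OF finV] by (simp add: card_carrier_coord_space)
  also have "\<dots> \<le> (?q ^ m) ^ j"
    by (rule choose_le_power)
  finally show ?thesis by simp
qed

text \<open>The matrices are grouped by their kernels, whose sizes are powers q^j with j \<le> m,
  and each class is bounded by the preceding count.\<close>

lemma sum_common_kernel_le:
  fixes w :: real
  assumes fin: "finite (carrier R)" and J: "finite J" and w: "w \<ge> 0"
  shows "(\<Sum>D\<in>J \<rightarrow>\<^sub>E carrier (coord_space R m). w ^ card (common_kernel R m J D)) \<le>
    (\<Sum>j\<le>m. real ((order R ^ m) ^ j * (order R ^ (m - j)) ^ card J) * w ^ (order R ^ j))"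
proof -
  interpret V: vectorspace R "coord_space R m"
    by (rule vectorspace_coord_space) (rule field_axioms)
  let ?V = "carrier (coord_space R m)" and ?q = "order R"
  let ?S = "\<lambda>j. {D \<in> J \<rightarrow>\<^sub>E ?V. card (common_kernel R m J D) = ?q ^ j}"
  have q: "?q \<ge> 2" by (rule order_ge_2[OF fin])
  have finV: "finite ?V"
    using fin by (rule finite_carrier_coord_space)
  have finD: "finite (J \<rightarrow>\<^sub>E ?V)"
    using J finV by (intro finite_PiE) auto
  have "J \<rightarrow>\<^sub>E ?V \<subseteq> (\<Union>j\<le>m. ?S j)"
  proof
    fix D assume D: "D \<in> J \<rightarrow>\<^sub>E ?V"
    let ?K = "common_kernel R m J D"
    have K: "subspace R ?K (coord_space R m)"
      using D by (intro subspace_common_kernel) auto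
    have KV: "?K \<subseteq> ?V"
      by (auto simp: common_kernel_def)
    obtain j where j: "card ?K = ?q ^ j"
      using V.subspace_card[OF K finite_subset[OF KV finV]] by blast
    moreover have "?q ^ j \<le> ?q ^ m"
      using card_mono[OF finV KV] j by (simp add: card_carrier_coord_space)
    then have "j \<le> m"
      using q by simp
    ultimately show "D \<in> (\<Union>j\<le>m. ?S j)"
      using D by auto
  qed
  then have "(\<Sum>D\<in>J \<rightarrow>\<^sub>E ?V. w ^ card (common_kernel R m J D)) \<le>
      (\<Sum>D\<in>(\<Union>j\<le>m. ?S j). w ^ card (common_kernel R m J D))"
    using w finD by (intro sum_mono2) auto
  \<comment> \<open>The classes are disjoint because the powers q^j are distinct for q \<ge>
    2.\<close>
  also have "\<dots> = (\<Sum>j\<le>m. \<Sum>D\<in>?S j. w ^ card (common_kernel R m J D))"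
    using q finD by (intro sum.UNION_disjoint) auto
  also have "\<dots> = (\<Sum>j\<le>m. real (card (?S j)) * w ^ (?q ^ j))"
    by simp
  also have "\<dots> \<le> (\<Sum>j\<le>m. real ((?q ^ m) ^ j * (?q ^ (m - j)) ^ card J) * w ^ (?q ^ j))"
    using w card_common_kernel_eq_le[OF fin J]
    by (intro sum_mono mult_right_mono) (auto simp del: of_nat_mult of_nat_power)
  finally show ?thesis .
qed

section \<open>Graphs of affine maps as flats\<close>

lemma graph_flat_alt:
  "x \<in> graph_flat R n m (A, b) \<longleftrightarrow>
    x \<in> carrier (coord_space R n) \<and> (\<forall>i\<in>{m..<n}. x i = dot R m (A i) x \<oplus> b i)"
  by (simp add: graph_flat_def)

text \<open>The case b = 0 is the direction shared by all graphs with linear part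
  \<open>A\<close>.\<close>

lemma subspace_graph_flat:
  assumes A: "A \<in> {m..<n} \<rightarrow> carrier (coord_space R m)" and mn: "m \<le> n"
  shows "subspace R (graph_flat R n m (A, \<lambda>i\<in>{m..<n}. \<zero>)) (coord_space R n)" (is "subspace R ?U _")
proof (rule subspace_coord_spaceI)
  have Ai: "A i \<in> {..<m} \<rightarrow> carrier R" if "i \<in> {m..<n}" for i
    using A that by (auto simp: carrier_coord_space PiE_def Pi_iff)
  have sub: "x \<in> {..<m} \<rightarrow> carrier R" if "x \<in> carrier (coord_space R n)" for x
    using that mn by (auto simp: carrier_coord_space PiE_def Pi_iff)
  show "?U \<subseteq> carrier (coord_space R n)"
    by (auto simp: graph_flat_alt)
  show "\<zero>\<^bsub>coord_space R n\<^esub> \<in> ?U"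
    using Ai mn by (auto simp: graph_flat_alt coord_space_simps dot_zero_right)
  fix u v assume u: "u \<in> ?U" and v: "v \<in> ?U"
  then have uv: "u \<in> carrier (coord_space R n)" "v \<in> carrier (coord_space R n)"
    by (auto simp: graph_flat_alt)
  have "(u \<oplus>\<^bsub>coord_space R n\<^esub> v) i = dot R m (A i) (u \<oplus>\<^bsub>coord_space R n\<^esub> v) \<oplus> \<zero>"
    if "i \<in> {m..<n}" for i
    using u v uv Ai[OF that] that sub mn
    by (simp add: graph_flat_alt add_coord_space dot_add_right)
  moreover have "u \<oplus>\<^bsub>coord_space R n\<^esub> v \<in> carrier (coord_space R n)"
    using uv by (auto simp: coord_space_simps)
  ultimately show "u \<oplus>\<^bsub>coord_space R n\<^esub> v \<in> ?U"
    by (simp add: graph_flat_alt)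
next
  have Ai: "A i \<in> {..<m} \<rightarrow> carrier R" if "i \<in> {m..<n}" for i
    using A that by (auto simp: carrier_coord_space PiE_def Pi_iff)
  have sub: "x \<in> {..<m} \<rightarrow> carrier R" if "x \<in> carrier (coord_space R n)" for x
    using that mn by (auto simp: carrier_coord_space PiE_def Pi_iff)
  fix c u assume c: "c \<in> carrier R" and u: "u \<in> ?U"
  then have uV: "u \<in> carrier (coord_space R n)"
    by (auto simp: graph_flat_alt)
  have "(c \<odot>\<^bsub>coord_space R n\<^esub> u) i = dot R m (A i) (c \<odot>\<^bsub>coord_space R n\<^esub> u) \<oplus> \<zero>"
    if "i \<in> {m..<n}" for i
    using u c uV Ai[OF that] that sub mn
    by (simp add: graph_flat_alt smult_coord_space dot_smult_right)
  moreover have "c \<odot>\<^bsub>coord_space R n\<^esub> u \<in> carrier (coord_space R n)"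
    using uV c by (auto simp: coord_space_simps)
  ultimately show "c \<odot>\<^bsub>coord_space R n\<^esub> u \<in> ?U"
    by (simp add: graph_flat_alt)
qed

text \<open>Restriction to the first m coordinates is a bijection, with inverse sending z to (z, A z
  + b).\<close>

lemma card_graph_flat:
  assumes f: "(A, b) \<in> affine_maps R n m" and mn: "m \<le> n"
  shows "card (graph_flat R n m (A, b)) = order R ^ m"
proof -
  have A: "A i \<in> {..<m} \<rightarrow> carrier R" and b: "b i \<in> carrier R" if "i \<in> {m..<n}" for i
    using f that by (auto simp: affine_maps_def carrier_coord_space PiE_def Pi_iff)
  let ?g = "\<lambda>z. \<lambda>i\<in>{..<n}. if i < m then z i else dot R m (A i) z \<oplus> b i"
  have "bij_betw ?g (carrier (coord_space R m)) (graph_flat R n m (A, b))"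
  proof (rule bij_betw_byWitness[where f' = "\<lambda>x. restrict x {..<m}"], goal_cases)
    case 1
    show ?case
    proof
      fix z assume "z \<in> carrier (coord_space R m)"
      note PiE_arb[OF this[unfolded carrier_coord_space]]
      then have z: "z i = undefined" if "\<not> i < m" for i
        using that by simp
      show "restrict (?g z) {..<m} = z"
      proof
        fix i show "restrict (?g z) {..<m} i = z i"
          using mn z[of i] by (cases "i < m") auto
      qed
    qed
  next
    case 2
    show ?case
    proof
      fix x assume x: "x \<in> graph_flat R n m (A, b)"
      then have "x \<in> {..<m} \<rightarrow> carrier R"
        using mn by (auto simp: graph_flat_alt carrier_coord_space PiE_def Pi_iff)
      then have "dot R m (A i) (restrict x {..<m}) = dot R m (A i) x" if "i \<in> {m..<n}" for i
        using A[OF that] by (intro dot_cong) auto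
      moreover have xV: "x \<in> {..<n} \<rightarrow>\<^sub>E carrier R"
        using x by (simp add: graph_flat_alt carrier_coord_space)
      ultimately have "?g (restrict x {..<m}) i = x i" for i
        using x mn PiE_arb[OF xV] by (cases "i < m"; cases "i < n") (simp_all add: graph_flat_alt)
      then show "?g (restrict x {..<m}) = x" ..
    qed
  next
    case 3
    show ?case
    proof (rule image_subsetI)
      fix z assume "z \<in> carrier (coord_space R m)"
      then have z: "z \<in> {..<m} \<rightarrow> carrier R"
        by (auto simp: carrier_coord_space)
      have "dot R m (A i) (?g z) = dot R m (A i) z" if "i \<in> {m..<n}" for i
        using A[OF that] z mn by (intro dot_cong) auto
      moreover have "?g z i \<in> carrier R" if "i < n" for i
      proof (cases "i < m")
        case True
        then show ?thesis using z that by auto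
      next
        case False
        then show ?thesis using z A[of i] b[of i] that by simp
      qed
      ultimately show "?g z \<in> graph_flat R n m (A, b)"
        by (auto simp: graph_flat_alt carrier_coord_space)
    qed
  next
    case 4
    show ?case
      using mn by (auto simp: graph_flat_alt carrier_coord_space PiE_def Pi_iff)
  qed
  from bij_betw_same_card[OF this] show ?thesis
    by (simp add: card_carrier_coord_space)
qed

text \<open>The graph is the translate by (0, b) of the graph with the same linear part and b = 0.
  The dimension of the latter is m because it has q^m elements.\<close>

lemma graph_flat_in_flats:
  assumes f: "(A, b) \<in> affine_maps R n m" and mn: "m \<le> n" and fin: "finite (carrier R)"
  shows "graph_flat R n m (A, b) \<in> flats R n m"
proof -
  interpret V: vectorspace R "coord_space R n"
    by (rule vectorspace_coord_space) (rule field_axioms)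
  have A: "A i \<in> {..<m} \<rightarrow> carrier R" and b: "b i \<in> carrier R" if "i \<in> {m..<n}" for i
    using f that by (auto simp: affine_maps_def carrier_coord_space PiE_def Pi_iff)
  let ?U = "graph_flat R n m (A, \<lambda>i\<in>{m..<n}. \<zero>)"
  let ?a = "\<lambda>i\<in>{..<n}. if i < m then \<zero> else b i"
  have U: "subspace R ?U (coord_space R n)"
    using f mn by (intro subspace_graph_flat) (auto simp: affine_maps_def)
  have UV: "?U \<subseteq> carrier (coord_space R n)"
    by (auto simp: graph_flat_alt)
  then have finU: "finite ?U"
    using finite_carrier_coord_space[OF fin] finite_subset by blast
  have "card ?U = order R ^ m"
    using f mn by (intro card_graph_flat) (auto simp: affine_maps_def)
  then have dim: "vectorspace.dim R (V.vs ?U) = m"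
    using V.subspace_card[OF U finU] order_ge_2[OF fin] by simp
  have a: "?a \<in> carrier (coord_space R n)"
    using b by (auto simp: carrier_coord_space)
  have "graph_flat R n m (A, b) = ?a <+\<^bsub>coord_space R n\<^esub> ?U"
  proof (intro equalityI subsetI)
    fix x assume x: "x \<in> graph_flat R n m (A, b)"
    then have xV: "x \<in> carrier (coord_space R n)"
      by (simp add: graph_flat_alt)
    then have xm: "x \<in> {..<m} \<rightarrow> carrier R"
      using mn by (auto simp: carrier_coord_space PiE_def Pi_iff)
    let ?u = "\<lambda>i\<in>{..<n}. if i < m then x i else dot R m (A i) x"
    have dot_u: "dot R m (A i) ?u = dot R m (A i) x" if "i \<in> {m..<n}" for i
      using A[OF that] xm mn by (intro dot_cong) auto
    have "?u i \<in> carrier R" if "i < n" for i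
    proof (cases "i < m")
      case True
      then show ?thesis using xm that by auto
    next
      case False
      then show ?thesis using xm A[of i] that by simp
    qed
    then have "?u \<in> ?U"
      using dot_u xm A by (auto simp: graph_flat_alt carrier_coord_space)
    moreover have "x = ?a \<oplus>\<^bsub>coord_space R n\<^esub> ?u"
    proof
      fix i
      consider "i < m" | "i \<in> {m..<n}" | "i \<ge> n" by fastforce
      then show "x i = (?a \<oplus>\<^bsub>coord_space R n\<^esub> ?u) i"
      proof cases
        case 1
        then show ?thesis using mn xm by (auto simp: add_coord_space Pi_iff)
      next
        case 2
        then show ?thesis
          using x b[OF 2] A[OF 2] xm by (simp add: add_coord_space graph_flat_alt a_comm)
      next
        case 3
        then show ?thesis
          using xV by (simp add: coord_space_simps PiE_iff extensional_def)
      qed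
    qed
    ultimately show "x \<in> ?a <+\<^bsub>coord_space R n\<^esub> ?U"
      unfolding a_l_coset_def' by blast
  next
    fix x assume "x \<in> ?a <+\<^bsub>coord_space R n\<^esub> ?U"
    then obtain u where u: "u \<in> ?U" and x: "x = ?a \<oplus>\<^bsub>coord_space R n\<^esub> u"
      unfolding a_l_coset_def' by blast
    have uV: "u \<in> carrier (coord_space R n)"
      using u UV by blast
    then have um: "u \<in> {..<m} \<rightarrow> carrier R"
      using mn by (auto simp: carrier_coord_space PiE_def Pi_iff)
    have "dot R m (A i) x = dot R m (A i) u" if "i \<in> {m..<n}" for i
      using A[OF that] um mn by (intro dot_cong) (auto simp: x add_coord_space Pi_iff)
    moreover have "x \<in> carrier (coord_space R n)"
      unfolding x using a uV by (rule V.M.add.m_closed)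
    moreover have "x i = dot R m (A i) u \<oplus> b i" if "i \<in> {m..<n}" for i
      using u that A[OF that] b[OF that] um by (simp add: x add_coord_space graph_flat_alt a_comm)
    ultimately show "x \<in> graph_flat R n m (A, b)"
      by (simp add: graph_flat_alt)
  qed
  then show ?thesis
    unfolding flats_def using a U dim by blast
qed

section \<open>Counting all flats and the union bound\<close>

lemma flat_properties:
  assumes fin: "finite (carrier R)" and L: "L \<in> flats R n m"
  shows "L \<subseteq> carrier (coord_space R n)" "card L = order R ^ m"
    and "\<exists>a\<in>carrier (coord_space R n). \<exists>B \<subseteq> carrier (coord_space R n).
      card B = m \<and> L = a <+\<^bsub>coord_space R n\<^esub> module.span R (coord_space R n) B"
proof -
  interpret V: vectorspace R "coord_space R n"
    by (rule vectorspace_coord_space) (rule field_axioms)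
  let ?V = "carrier (coord_space R n)"
  obtain a U where a: "a \<in> ?V" and U: "subspace R U (coord_space R n)"
    and dim: "vectorspace.dim R (V.vs U) = m" and L_eq: "L = a <+\<^bsub>coord_space R n\<^esub> U"
    using L unfolding flats_def by blast
  have UV: "U \<subseteq> ?V"
    using U by (simp add: subspace_def submodule_def)
  then have finU: "finite U"
    using finite_carrier_coord_space[OF fin] finite_subset by blast
  have L_im: "L = (\<lambda>u. a \<oplus>\<^bsub>coord_space R n\<^esub> u) ` U"
    by (auto simp: L_eq a_l_coset_def')
  show "L \<subseteq> ?V"
    using a UV by (auto simp: L_im)
  have "inj_on (\<lambda>u. a \<oplus>\<^bsub>coord_space R n\<^esub> u) U"
    using a UV V.M.add.Units_l_cancel[of a] by (intro inj_onI) (auto simp: subset_eq)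
  then show "card L = order R ^ m"
    using V.subspace_card[OF U finU] dim by (simp add: L_im card_image)
  obtain B where "B \<subseteq> U" "card B = m" "V.module.span B = U"
    using V.subspace_obtain_basis[OF U finU] dim by metis
  then show "\<exists>a\<in>?V. \<exists>B \<subseteq> ?V. card B = m \<and> L = a <+\<^bsub>coord_space R n\<^esub> V.module.span B"
    using a UV L_eq by (intro bexI[of _ a] exI[of _ B]) auto
qed

text \<open>A flat is coded, in many ways, by a base point and m vectors spanning its direction. The
  bound is exactly the reciprocal of the q^m-th power of the threshold, so no constant enters the
  upper bound on the probability.\<close>

lemma card_flats_le:
  assumes fin: "finite (carrier R)"
  shows "finite (flats R n m)" "card (flats R n m) \<le> order R ^ (n * (m + 1))"
proof -
  let ?V = "carrier (coord_space R n)"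
  let ?B = "{B. B \<subseteq> ?V \<and> card B = m}"
  have finV: "finite ?V"
    using fin by (rule finite_carrier_coord_space)
  have finB: "finite ?B"
    by (rule finite_subset[of _ "Pow ?V"]) (use finV in auto)
  let ?f = "\<lambda>(a, B). a <+\<^bsub>coord_space R n\<^esub> module.span R (coord_space R n) B"
  have sub: "flats R n m \<subseteq> ?f ` (?V \<times> ?B)"
  proof
    fix L assume "L \<in> flats R n m"
    from flat_properties(3)[OF fin this] show "L \<in> ?f ` (?V \<times> ?B)"
      by (auto simp: image_iff)
  qed
  have fin_im: "finite (?f ` (?V \<times> ?B))"
    using finV finB by (intro finite_imageI finite_cartesian_product)
  then show "finite (flats R n m)"
    by (rule finite_subset[OF sub])
  have "card (flats R n m) \<le> card (?f ` (?V \<times> ?B))"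
    by (rule card_mono[OF fin_im sub])
  also have "\<dots> \<le> card (?V \<times> ?B)"
    using finV finB by (intro card_image_le finite_cartesian_product)
  also have "\<dots> = order R ^ n * (order R ^ n choose m)"
    using n_subsets[OF finV] by (simp add: card_cartesian_product card_carrier_coord_space)
  also have "\<dots> \<le> order R ^ n * (order R ^ n) ^ m"
    by (intro mult_left_mono choose_le_power) auto
  also have "\<dots> = order R ^ (n * (m + 1))"
    by (simp add: power_add power_mult)
  finally show "card (flats R n m) \<le> order R ^ (n * (m + 1))" .
qed

lemma prob_contains_flat_le:
  assumes fin: "finite (carrier R)" and \<theta>: "\<theta> \<in> {0..1}"
  shows "prob_contains_flat R n m \<theta> \<le> real (order R) ^ (n * (m + 1)) * \<theta> ^ (order R ^ m)"
proof -
  have "prob_contains_flat R n m \<theta> \<le> real (card (flats R n m)) * \<theta> ^ (order R ^ m)"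
    unfolding prob_contains_flat_def
    using flat_properties[OF fin] card_flats_le[OF fin] finite_carrier_coord_space[OF fin] \<theta>
    by (intro prob_random_subset_union_bound)
  also have "\<dots> \<le> real (order R ^ (n * (m + 1))) * \<theta> ^ (order R ^ m)"
    using \<theta> card_flats_le(2)[OF fin]
    by (intro mult_right_mono of_nat_mono) auto
  finally show ?thesis by simp
qed

text \<open>If the graphs of \<open>f\<close> and \<open>g = (A', b')\<close> meet above \<open>z\<close>, then \<open>g\<close> is determined by \<open>z\<close> and the
  difference \<open>D\<close> of the linear parts, and the meet is no larger than the kernel of \<open>D\<close>.\<close>

lemma sum_graph_flat_Int_le:
  fixes w :: real
  assumes fin: "finite (carrier R)" and mn: "m \<le> n" and w: "w \<ge> 1"
    and f: "f \<in> affine_maps R n m"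
  shows "(\<Sum>g\<in>affine_maps R n m. w ^ card (graph_flat R n m f \<inter> graph_flat R n m g)) \<le>
    real (card (affine_maps R n m)) + real (order R ^ m) *
      (\<Sum>D\<in>{m..<n} \<rightarrow>\<^sub>E carrier (coord_space R m). w ^ card (common_kernel R m {m..<n} D))"
proof -
  let ?V = "carrier (coord_space R m)" and ?H = "affine_maps R n m"
  let ?\<D> = "{m..<n} \<rightarrow>\<^sub>E ?V"
  let ?L = "graph_flat R n m" and ?K = "common_kernel R m {m..<n}"
  obtain A b where f_eq: "f = (A, b)" by (cases f)
  have A: "A i \<in> {..<m} \<rightarrow> carrier R" and b: "b i \<in> carrier R" if "i \<in> {m..<n}" for i
    using f that by (auto simp: f_eq affine_maps_def carrier_coord_space PiE_def Pi_iff)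
  have finV: "finite ?V"
    using fin by (rule finite_carrier_coord_space)
  have finH: "finite ?H"
    using fin by (rule finite_affine_maps)
  define G where "G = {g \<in> ?H. ?L f \<inter> ?L g \<noteq> {}}"
  \<comment> \<open>Any common point serves. It is fixed once for each \<open>g\<close>, so that
    \<open>g\<close> can be coded by \<open>(D g, z g)\<close>.\<close>
  define pt where "pt g = (SOME x. x \<in> ?L f \<inter> ?L g)" for g
  define D where "D g = (\<lambda>i\<in>{m..<n}. \<lambda>k\<in>{..<m}. fst g i k \<ominus> A i k)" for g :: "(nat \<Rightarrow> nat \<Rightarrow> 'a) \<times> (nat \<Rightarrow> 'a)"
  define z where "z g = restrict (pt g) {..<m}" for g
  have pt: "pt g \<in> ?L f" "pt g \<in> ?L g" if "g \<in> G" for g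
    using someI_ex[of "\<lambda>x. x \<in> ?L f \<inter> ?L g"] that by (auto simp: pt_def G_def)
  have Lm: "x \<in> {..<m} \<rightarrow> carrier R" if "x \<in> ?L g" for x g
    using that mn by (auto simp: graph_flat_def carrier_coord_space PiE_def Pi_iff)
  have A': "fst g i \<in> {..<m} \<rightarrow> carrier R" and b': "snd g i \<in> carrier R"
    if "g \<in> G" "i \<in> {m..<n}" for g i
    using that by (auto simp: G_def affine_maps_def carrier_coord_space PiE_def Pi_iff)
  have zV: "z g \<in> ?V" if "g \<in> G" for g
    using Lm[OF pt(1)[OF that]] by (auto simp: z_def carrier_coord_space)
  have DV: "D g \<in> ?\<D>" if "g \<in> G" for g
    using A A'[OF that] by (fastforce simp: D_def carrier_coord_space Pi_iff)
  have graph: "x i = dot R m (fst g i) x \<oplus> snd g i" if "x \<in> ?L g" "i \<in> {m..<n}" for x g i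
    using that by (auto simp: graph_flat_def split: prod.splits)
  have dot_D: "dot R m (D g i) x = dot R m (fst g i) x \<ominus> dot R m (A i) x"
    if "g \<in> G" "i \<in> {m..<n}" "x \<in> {..<m} \<rightarrow> carrier R" for g i x
    using dot_diff_left[OF A'[OF that(1,2)] A[OF that(2)] that(3)] that(2) by (simp add: D_def)
  have inj: "inj_on (\<lambda>g. (D g, z g)) G"
  proof (rule inj_onI)
    fix g h assume gh: "g \<in> G" "h \<in> G" "(D g, z g) = (D h, z h)"
    have A_eq: "fst g i k = fst h i k" if "i \<in> {m..<n}" "k < m" for i k
    proof -
      have "fst g i k \<ominus> A i k = fst h i k \<ominus> A i k"
        using gh(3) that by (auto simp: D_def fun_eq_iff split: if_splits)
      moreover have "fst g i k \<in> carrier R" "fst h i k \<in> carrier R" "A i k \<in> carrier R"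
        using A'[OF gh(1) that(1)] A'[OF gh(2) that(1)] A[OF that(1)] that(2) by auto
      ultimately show ?thesis
        by (simp add: a_minus_def)
    qed
    have gH: "g \<in> ?H" "h \<in> ?H"
      using gh by (auto simp: G_def)
    have Ai_eq: "fst g i = fst h i" if "i \<in> {m..<n}" for i
    proof
      fix k show "fst g i k = fst h i k"
        using A_eq[OF that] gH that
        by (cases "k < m") (fastforce simp: affine_maps_def carrier_coord_space PiE_iff extensional_def)+
    qed
    \<comment> \<open>The common point lies on the graph of \<open>f\<close>, so its first m
      coordinates determine it. Evaluating the equation of \<open>g\<close> there recovers the
      constant term.\<close>
    have b_eq: "snd g i = snd h i" if i: "i \<in> {m..<n}" for i
    proof -
      note pm = Lm[OF pt(1)[OF gh(1)]] Lm[OF pt(1)[OF gh(2)]]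
      have z_eq: "pt g k = pt h k" if "k < m" for k
        using gh(3) that by (auto simp: z_def fun_eq_iff split: if_splits)
      have "dot R m (A i) (pt g) = dot R m (A i) (pt h)"
        using A[OF i] pm(2) z_eq by (intro dot_cong) auto
      then have "pt g i = pt h i"
        using graph[OF pt(1)[OF gh(1)], of i] graph[OF pt(1)[OF gh(2)], of i]
        using pt(1)[OF gh(1)] pt(1)[OF gh(2)] i by (simp add: f_eq graph_flat_alt)
      moreover have "dot R m (fst g i) (pt g) = dot R m (fst h i) (pt h)"
        unfolding Ai_eq[OF i] using A'[OF gh(2) i] pm(2) z_eq by (intro dot_cong) auto
      ultimately have "dot R m (fst h i) (pt h) \<oplus> snd g i = dot R m (fst h i) (pt h) \<oplus> snd h i"
        using graph[OF pt(2)[OF gh(1)] i] graph[OF pt(2)[OF gh(2)] i] by simp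
      then show ?thesis
        using A'[OF gh(2) i] pm(2) b'[OF gh(1) i] b'[OF gh(2) i] by simp
    qed
    have mem: "fst g \<in> ?\<D>" "fst h \<in> ?\<D>"
        "snd g \<in> {m..<n} \<rightarrow>\<^sub>E carrier R" "snd h \<in> {m..<n} \<rightarrow>\<^sub>E carrier R"
      using gH by (simp_all add: affine_maps_def mem_Times_iff)
    show "g = h"
      by (rule prod_eqI[OF PiE_ext[OF mem(1,2) Ai_eq] PiE_ext[OF mem(3,4) b_eq]])
  qed
  have card_le: "card (?L f \<inter> ?L g) \<le> card (?K (D g))" if g: "g \<in> G" for g
  proof (rule card_inj_on_le)
    \<comment> \<open>Subtracting the two affine equations shows that the matrix \<open>D g\<close>
      takes the constant value b - b' on the meet, so differences from \<open>pt g\<close> lie in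
      its kernel. Points of the graph of \<open>f\<close> are told apart by their first m
      coordinates, so this map is injective.\<close>
    let ?\<tau> = "\<lambda>x. \<lambda>k\<in>{..<m}. x k \<ominus> pt g k"
    show "inj_on ?\<tau> (?L f \<inter> ?L g)"
    proof (rule inj_onI)
      fix x y assume x: "x \<in> ?L f \<inter> ?L g" and y: "y \<in> ?L f \<inter> ?L g" and eq: "?\<tau> x = ?\<tau> y"
      have xm: "x \<in> {..<m} \<rightarrow> carrier R" and ym: "y \<in> {..<m} \<rightarrow> carrier R"
        using x y Lm by blast+
      have low: "x k = y k" if "k < m" for k
      proof -
        have "x k \<ominus> pt g k = y k \<ominus> pt g k"
          using fun_cong[OF eq, of k] that by simp
        moreover have "x k \<in> carrier R" "y k \<in> carrier R" "pt g k \<in> carrier R"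
          using xm ym Lm[OF pt(1)[OF g]] that by auto
        ultimately show ?thesis
          by (simp add: a_minus_def)
      qed
      show "x = y"
      proof
        fix i
        consider "i < m" | "i \<in> {m..<n}" | "i \<ge> n" by fastforce
        then show "x i = y i"
        proof cases
          case 1
          then show ?thesis by (rule low)
        next
          case 2
          have "dot R m (A i) x = dot R m (A i) y"
            using A[OF 2] ym low by (intro dot_cong) auto
          then show ?thesis
            using x y 2 by (simp add: f_eq graph_flat_alt)
        next
          case 3
          then show ?thesis
            using x y by (auto simp: f_eq graph_flat_alt carrier_coord_space PiE_iff extensional_def)
        qed
      qed
    qed
    show "?\<tau> ` (?L f \<inter> ?L g) \<subseteq> ?K (D g)"
    proof (rule image_subsetI)
      fix x assume x: "x \<in> ?L f \<inter> ?L g"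
      have xm: "x \<in> {..<m} \<rightarrow> carrier R" and pm: "pt g \<in> {..<m} \<rightarrow> carrier R"
        using x Lm pt(1)[OF g] by blast+
      have Dx: "dot R m (D g i) y = b i \<ominus> snd g i"
        if y: "y \<in> ?L f \<inter> ?L g" and i: "i \<in> {m..<n}" for y i
      proof -
        have ym: "y \<in> {..<m} \<rightarrow> carrier R"
          using y Lm by blast
        have c: "dot R m (fst g i) y \<in> carrier R" "dot R m (A i) y \<in> carrier R"
          using ym A[OF i] A'[OF g i] by auto
        have "dot R m (fst g i) y \<oplus> snd g i = dot R m (A i) y \<oplus> b i"
          using y i graph[of y g i] by (simp add: f_eq graph_flat_alt)
        then have "dot R m (fst g i) y = dot R m (A i) y \<oplus> b i \<ominus> snd g i"
          using c b[OF i] b'[OF g i] by (metis a_minus_def add.inv_solve_right add.m_closed)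
        then show ?thesis
          unfolding dot_D[OF g i ym] using c b[OF i] b'[OF g i]
          by (simp add: a_minus_def a_ac r_neg r_neg1 r_neg2)
      qed
      have "dot R m (D g i) (?\<tau> x) = \<zero>" if i: "i \<in> {m..<n}" for i
      proof -
        have Di: "D g i \<in> {..<m} \<rightarrow> carrier R"
          using DV[OF g] i by (auto simp: carrier_coord_space PiE_def Pi_iff)
        show ?thesis
          unfolding dot_diff_right[OF Di xm pm]
          using Dx[OF x i] Dx[of "pt g" i] pt[OF g] i b[OF i] b'[OF g i]
          by (simp add: a_minus_def r_neg)
      qed
      moreover have "?\<tau> x \<in> ?V"
        using xm pm by (auto simp: carrier_coord_space Pi_iff)
      ultimately show "?\<tau> x \<in> ?K (D g)"
        by (simp add: common_kernel_def)
    qed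
    show "finite (?K (D g))"
      by (rule finite_subset[OF _ finV]) (auto simp: common_kernel_def)
  qed
  have "(\<Sum>g\<in>?H. w ^ card (?L f \<inter> ?L g)) =
      (\<Sum>g\<in>?H - G. w ^ card (?L f \<inter> ?L g)) + (\<Sum>g\<in>G. w ^ card (?L f \<inter> ?L g))"
    using finH by (intro sum.subset_diff) (auto simp: G_def)
  \<comment> \<open>Graphs disjoint from that of \<open>f\<close> contribute w^0 = 1 each. They
    account for the leading 1 of the normalised second moment.\<close>
  also have "(\<Sum>g\<in>?H - G. w ^ card (?L f \<inter> ?L g)) = real (card (?H - G))"
    by (simp add: G_def)
  also have "\<dots> \<le> real (card ?H)"
    using finH by (intro of_nat_mono card_mono) auto
  also have "(\<Sum>g\<in>G. w ^ card (?L f \<inter> ?L g)) \<le> (\<Sum>g\<in>G. w ^ card (?K (fst (D g, z g))))"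
    using card_le w by (intro sum_mono power_increasing) auto
  also have "\<dots> = (\<Sum>p\<in>(\<lambda>g. (D g, z g)) ` G. w ^ card (?K (fst p)))"
    using inj by (simp add: sum.reindex)
  \<comment> \<open>All pairs replace those that occur, so each matrix is counted once for every one
    of the q^m possible values of \<open>z\<close>.\<close>
  also have "\<dots> \<le> (\<Sum>p\<in>?\<D> \<times> ?V. w ^ card (?K (fst p)))"
    using DV zV finV w by (intro sum_mono2) (auto intro!: finite_PiE)
  also have "\<dots> = (\<Sum>E\<in>?\<D>. \<Sum>x\<in>?V. w ^ card (?K E))"
    by (subst sum.cartesian_product) (simp add: case_prod_beta)
  also have "\<dots> = real (order R ^ m) * (\<Sum>E\<in>?\<D>. w ^ card (?K E))"
    by (simp add: card_carrier_coord_space sum_distrib_left)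
  finally show ?thesis by simp
qed

text \<open>For each j there are q^m choices of z and at most q^(mj) q^((m-j)(n-m)) matrices.
  Dividing by the q^((m+1)(n-m)) graphs leaves (q^m / q^(n-m))^(j+1).\<close>

lemma prob_contains_flat_ge:
  assumes fin: "finite (carrier R)" and mn: "m \<le> n" and \<theta>: "0 < \<theta>" "\<theta> \<le> 1"
  shows "1 / (1 + (\<Sum>j\<le>m. (real (order R) ^ m / real (order R) ^ (n - m)) ^ (j + 1) *
      (1 / \<theta>) ^ (order R ^ j))) \<le> prob_contains_flat R n m \<theta>" (is "1 / ?R \<le> _")
proof -
  let ?H = "affine_maps R n m" and ?L = "graph_flat R n m" and ?q = "order R"
  let ?S = "carrier (coord_space R n)"
  have q: "?q > 0" using order_ge_2[OF fin] by simp
  have cardH: "card ?H = ?q ^ ((m + 1) * (n - m))"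
    by (rule card_affine_maps)
  have finS: "finite ?S"
    using fin by (rule finite_carrier_coord_space)
  have "1 / ?R \<le> measure_pmf.prob (random_subset ?S \<theta>) {X. \<exists>f\<in>?H. ?L f \<subseteq> X}"
  proof (rule prob_random_subset_second_moment)
    show "finite ?S" by (rule finS)
    show "finite ?H" by (rule finite_affine_maps[OF fin])
    show "?H \<noteq> {}"
      using cardH q by (metis card.empty power_eq_0_iff less_numeral_extra(3))
    show "?L f \<subseteq> ?S" for f
      by (auto simp: graph_flat_def)
    show "card (?L f) = ?q ^ m" if "f \<in> ?H" for f
      using card_graph_flat[OF _ mn] that by (cases f) auto
    show "?R > 0"
      using \<theta> by (intro add_pos_nonneg sum_nonneg) auto
    fix f assume f: "f \<in> ?H"
    let ?w = "1 / \<theta>"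
    have w: "?w \<ge> 1" using \<theta> by simp
    have "(\<Sum>g\<in>?H. ?w ^ card (?L f \<inter> ?L g)) \<le> real (card ?H) + real (?q ^ m) *
        (\<Sum>D\<in>{m..<n} \<rightarrow>\<^sub>E carrier (coord_space R m). ?w ^ card (common_kernel R m {m..<n} D))"
      by (rule sum_graph_flat_Int_le[OF fin mn w f])
    also have "\<dots> \<le> real (card ?H) + real (?q ^ m) *
        (\<Sum>j\<le>m. real ((?q ^ m) ^ j * (?q ^ (m - j)) ^ card {m..<n}) * ?w ^ (?q ^ j))"
      using \<theta> by (intro add_left_mono mult_left_mono sum_common_kernel_le[OF fin]) auto
    also have "\<dots> = real (card ?H) + (\<Sum>j\<le>m. real (card ?H) *
        ((real ?q ^ m / real ?q ^ (n - m)) ^ (j + 1) * ?w ^ (?q ^ j)))"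
      unfolding sum_distrib_left
    proof (intro arg_cong2[where f = "(+)"] sum.cong refl)
      fix j assume "j \<in> {..m}"
      then have "(m + 1) * (n - m) = (m - j) * (n - m) + (n - m) * (j + 1)"
        by (simp add: mult.commute[of "n - m"] flip: add_mult_distrib)
      then have "real (card ?H) = (real ?q ^ (m - j)) ^ (n - m) * (real ?q ^ (n - m)) ^ (j + 1)"
        by (simp only: cardH of_nat_power of_nat_mult power_add power_mult)
      then have eq: "real (card ?H) * (real ?q ^ m / real ?q ^ (n - m)) ^ (j + 1) =
          (real ?q ^ m) ^ (j + 1) * (real ?q ^ (m - j)) ^ (n - m)"
        using q by (simp add: power_divide del: power_Suc)
      have "real (?q ^ m) * (real ((?q ^ m) ^ j * (?q ^ (m - j)) ^ card {m..<n}) * ?w ^ (?q ^ j)) =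
          (real ?q ^ m) ^ (j + 1) * (real ?q ^ (m - j)) ^ (n - m) * ?w ^ (?q ^ j)"
        by simp
      then show "real (?q ^ m) * (real ((?q ^ m) ^ j * (?q ^ (m - j)) ^ card {m..<n}) * ?w ^ (?q ^ j)) =
          real (card ?H) * ((real ?q ^ m / real ?q ^ (n - m)) ^ (j + 1) * ?w ^ (?q ^ j))"
        by (simp only: eq[symmetric] mult.assoc)
    qed
    also have "\<dots> = ?R * real (card ?H)"
      by (simp add: sum_distrib_left algebra_simps)
    finally show "(\<Sum>g\<in>?H. ?w ^ card (?L f \<inter> ?L g)) \<le> ?R * real (card ?H)" .
  qed (use \<theta> in auto)
  also have "\<dots> \<le> prob_contains_flat R n m \<theta>"
    unfolding prob_contains_flat_def
  proof (intro measure_pmf.finite_measure_mono)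
    show "{X. \<exists>f\<in>?H. ?L f \<subseteq> X} \<subseteq> {X. \<exists>L\<in>flats R n m. L \<subseteq> X}"
      using graph_flat_in_flats[OF _ mn fin] by (auto split: prod.splits)
  qed auto
  finally show ?thesis .
qed

end

section \<open>Asymptotics\<close>

text \<open>Meets of q^j points contribute the q^j-th power of 1/\<theta>, so these powers of the
  threshold are needed for every j. The case j = m, with value q^(-n(m+1)), explains the choice of
  threshold.\<close>

lemma threshold_power:
  fixes q n m j :: nat
  assumes q: "q \<ge> 2" and j: "j \<le> m"
  shows "(real q powr (- (real n * (real m + 1) * real q powr (- real m)))) ^ (q ^ j) =
    real q powr (- (real n * (real m + 1) / real q ^ (m - j)))"
proof -
  have "real q powr (- real m) * real q ^ j = 1 / real q ^ (m - j)"
  proof -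
    have "real q ^ m = real q ^ (m - j) * real q ^ j"
      using j by (simp flip: power_add)
    then show ?thesis
      using q by (simp add: powr_minus powr_realpow field_simps)
  qed
  then have "real n * (real m + 1) * real q powr (- real m) * real q ^ j =
      real n * (real m + 1) / real q ^ (m - j)"
    by (simp add: mult.assoc)
  moreover have "(real q powr (- (real n * (real m + 1) * real q powr (- real m)))) ^ (q ^ j) =
      real q powr (- (real n * (real m + 1) * real q powr (- real m) * real q ^ j))"
    using q by (simp add: powr_powr flip: powr_realpow)
  ultimately show ?thesis by simp
qed

text \<open>Decay in n of the terms with j < m requires m + 1 < (j + 1) q^(m-j). In integers this
  gives m + 2, and hence a gap uniform in q. In the excluded case, where j = 0, the inequality would
  read 3 \<le> 2.\<close>

lemma Suc_Suc_le_mult_power: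
  fixes q m j :: nat
  assumes q: "q \<ge> 2" and j: "j < m" and nondeg: "\<not> (q = 2 \<and> m = 1)"
  shows "m + 2 \<le> (j + 1) * q ^ (m - j)"
proof -
  obtain d where d: "m = j + Suc d"
    using j less_iff_Suc_add by auto
  have two: "2 ^ k \<ge> k + (1 :: nat)" for k
    by (induction k) auto
  have pow: "q ^ Suc d \<ge> 2 ^ Suc d"
    using q by (rule power_mono) simp
  show ?thesis
  proof (cases "j = 0")
    case True
    have "d + 3 \<le> q ^ Suc d"
    proof (cases "d = 0")
      case True
      \<comment> \<open>Here m = 1 and the claim is 3 \<le> q, which is what \<open>nondeg\<close>
        supplies.\<close>
      then show ?thesis using q nondeg d \<open>j = 0\<close> by simp
    next
      case False
      then show ?thesis using pow two[of d] by simp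
    qed
    then show ?thesis using True d by simp
  next
    case False
    then have "j + d + 3 \<le> (j + 1) * (d + 2)"
      by (cases j) auto
    also have "\<dots> \<le> (j + 1) * q ^ Suc d"
      using pow two[of "Suc d"] by (intro mult_left_mono) auto
    finally show ?thesis using d by simp
  qed
qed

text \<open>The case \<open>q = 2\<close>, \<open>m = 1\<close> is exceptional: every pair of points is a line, so the points
  themselves (\<open>j = 0\<close>) contribute a term which does not decay with \<open>n\<close>.\<close>

lemma second_moment_term_le:
  fixes q n m j M :: nat and c :: real
  defines "t \<equiv> real q powr (- (real n * (real m + 1) * real q powr (- real m)))"
  defines "K \<equiv> 2 * M * (M + 1)"
  assumes q: "q \<ge> 2" and m: "0 < m" "m \<le> M" and j: "j \<le> m" and mn: "m \<le> n"
    and n: "K * (M + 2) \<le> n" and c: "c \<ge> 1"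
  shows "(real q ^ m / real q ^ (n - m)) ^ (j + 1) * (1 / (c * t)) ^ (q ^ j) \<le>
    real q ^ K * (1 / c) ^ q + 2 powr (real K - real n / (real M + 2)) +
    (if q = 2 then 2 ^ K / c else 0)" (is "?T \<le> ?E1 + ?E2 + ?E3")
proof -
  \<comment> \<open>This is the exponent of q in the term once the power of 1/c is split
    off.\<close>
  define e where "e = (2 * real m - real n) * (real j + 1) + real n * (real m + 1) / real q ^ (m - j)"
  have "real q ^ m / real q ^ (n - m) = real q powr (2 * real m - real n)"
  proof -
    have "real q ^ m / real q ^ (n - m) = real q powr real m / real q powr (real n - real m)"
      using q mn by (simp add: of_nat_diff flip: powr_realpow)
    also have "\<dots> = real q powr (real m - (real n - real m))"
      by (simp only: powr_diff)
    finally show ?thesis by simp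
  qed
  then have 1: "(real q ^ m / real q ^ (n - m)) ^ (j + 1) =
      real q powr ((2 * real m - real n) * (real j + 1))"
    using q by (simp add: powr_powr add.commute flip: powr_realpow del: power_Suc)
  have 2: "(1 / (c * t)) ^ (q ^ j) =
      (1 / c) ^ (q ^ j) * real q powr (real n * (real m + 1) / real q ^ (m - j))"
    unfolding power_one_over power_mult_distrib t_def threshold_power[OF q j]
    by (simp add: powr_minus field_simps)
  have T: "?T = real q powr e * (1 / c) ^ (q ^ j)"
    unfolding 1 2 e_def by (simp add: powr_add)
  have E: "?E1 \<ge> 0" "?E2 \<ge> 0" "?E3 \<ge> 0"
    using c by auto
  \<comment> \<open>The exponent is 2m(j+1) plus a multiple of n, and \<open>K\<close> bounds the
    first part for all admissible m and j.\<close>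
  have qm: "m * (j + 1) \<le> M * (M + 1)"
    using m j by (intro mult_mono) auto
  then have K: "2 * real m * (real j + 1) \<le> real K"
    using of_nat_mono[OF qm, where 'a = real] by (simp add: K_def algebra_simps)
  consider "j = m" | "j < m" "\<not> (q = 2 \<and> m = 1)" | "j < m" "q = 2" "m = 1"
    using j by fastforce
  then show ?thesis
  proof cases
    case 1
    \<comment> \<open>For j = m the multiples of n cancel and e = 2m(m+1), so all decay comes from
      the power of 1/c.\<close>
    then have "e \<le> real K"
      using K by (simp add: e_def algebra_simps)
    then have "real q powr e \<le> real q ^ K"
      using q by (simp flip: powr_realpow)
    moreover have "(1 / c) ^ (q ^ j) \<le> (1 / c) ^ q"
      using c q m 1 self_le_power[of q m] by (intro power_decreasing) auto
    ultimately have "?T \<le> ?E1"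
      unfolding T using c by (intro mult_mono) auto
    then show ?thesis using E by linarith
  next
    case 2
    \<comment> \<open>The excess of m + 2 over m + 1 makes (m+1)/q^(m-j) smaller than j + 1 by at
      least 1/(M+2), which gives decay in n.\<close>
    have "real m + 2 \<le> (real j + 1) * real q ^ (m - j)"
      using of_nat_mono[OF Suc_Suc_le_mult_power[OF q 2], where 'a = real]
      by (simp add: algebra_simps)
    then have "1 / real q ^ (m - j) \<le> (real j + 1) / (real m + 2)"
      using q by (simp add: field_simps)
    then have "(real m + 1) * (1 / real q ^ (m - j)) \<le> (real m + 1) * ((real j + 1) / (real m + 2))"
      by (intro mult_left_mono) auto
    also have "\<dots> = (real j + 1) - (real j + 1) / (real m + 2)"
      by (simp add: field_simps)
    also have "\<dots> \<le> (real j + 1) - 1 / (real M + 2)"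
      using m by (intro diff_left_mono frac_le) auto
    finally have "real n * ((real m + 1) * (1 / real q ^ (m - j))) \<le>
        real n * ((real j + 1) - 1 / (real M + 2))"
      by (intro mult_left_mono) auto
    then have e: "e \<le> real K - real n / (real M + 2)"
      using K by (simp add: e_def algebra_simps)
    \<comment> \<open>The lower bound on n makes the exponent nonpositive, so the base q can be
      lowered to 2 for a bound free of q.\<close>
    have "real K * (real M + 2) \<le> real n"
      using of_nat_mono[OF n, where 'a = real] by (simp add: algebra_simps)
    then have neg: "real K - real n / (real M + 2) \<le> 0"
      by (simp add: field_simps)
    have "real q powr e \<le> real q powr (real K - real n / (real M + 2))"
      using e q by simp
    also have "\<dots> \<le> ?E2"
      using neg q by (intro powr_mono2') auto
    finally have "?T \<le> ?E2 * 1"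
      unfolding T using c by (intro mult_mono power_le_one) auto
    then show ?thesis using E by linarith
  next
    case 3
    \<comment> \<open>Here j = 0, so e = (2 - n) + 2n/2, and only the first power of 1/c is
      available.\<close>
    then have "e = 2"
      by (simp add: e_def)
    then have "e \<le> real K"
      using K 3 by simp
    then have "real q powr e \<le> 2 powr real K"
      using 3 by (simp only: of_nat_numeral) (intro powr_mono, auto)
    then have "?T \<le> ?E3"
      unfolding T using 3 c by (simp add: powr_realpow divide_right_mono)
    then show ?thesis using E by linarith
  qed
qed

section \<open>Passage to the limit along sequences of fields and probabilities\<close>

context
  fixes F :: "nat \<Rightarrow> ('a, 'b) ring_scheme" and q m :: "nat \<Rightarrow> nat" and t :: "nat \<Rightarrow> real" and M :: nat
  assumes q: "\<And>n. q n \<ge> 2"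
    and F: "\<And>n. field (F n)" and ord: "\<And>n. order (F n) = q n"
    and m: "\<And>n. m n > 0" "\<And>n. m n \<le> M"
    and t: "\<And>n. t n = real (q n) powr (- (real n * (real (m n) + 1) * real (q n) powr (- real (m n))))"
begin

lemma finite_carrier_seq: "finite (carrier (F n))"
  using q[of n] ord[of n] by (intro card_ge_0_finite) (simp add: order_def)

lemma threshold_pos: "t n > 0"
  using q[of n] by (simp add: t)

lemma prob_contains_flat_le_ratio_power:
  assumes "\<theta> \<in> {0..1}"
  shows "prob_contains_flat (F n) n (m n) \<theta> \<le> (\<theta> / t n) ^ (q n ^ m n)"
proof -
  have "t n ^ (q n ^ m n) = real (q n) powr (- real (n * (m n + 1)))"
    using threshold_power[where n = n and m = "m n", OF q[of n] order_refl]
    by (simp add: t algebra_simps)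
  then have "t n ^ (q n ^ m n) = 1 / real (q n) ^ (n * (m n + 1))"
    using q[of n] by (simp add: powr_minus powr_realpow divide_inverse del: of_nat_mult of_nat_add)
  then show ?thesis
    using field.prob_contains_flat_le[OF F finite_carrier_seq assms, of n n "m n"]
    by (simp add: power_divide ord mult.commute)
qed

text \<open>Both kinds of threshold reduce to this. Each of the at most M + 1 terms of the second
  moment is bounded by \<open>err\<close>; \<open>err1\<close> and \<open>err2\<close> isolate the
  parts whose decay depends on \<theta>/t, while the part exponential in n always vanishes in the
  limit.\<close>

lemma prob_contains_flat_tendsto_1:
  defines "K \<equiv> 2 * M * (M + 1)"
  assumes \<theta>: "\<And>n. \<theta> n \<in> {0..1}" and c: "\<forall>\<^sub>F n in sequentially. \<theta> n / t n \<ge> 1"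
    and err1: "(\<lambda>n. real (q n) ^ K * (t n / \<theta> n) ^ q n) \<longlonglongrightarrow> 0"
    and err2: "(\<lambda>n. if q n = 2 then 2 ^ K * (t n / \<theta> n) else 0) \<longlonglongrightarrow> 0"
  shows "(\<lambda>n. prob_contains_flat (F n) n (m n) (\<theta> n)) \<longlonglongrightarrow> 1"
proof -
  define err where "err n = real (q n) ^ K * (t n / \<theta> n) ^ q n +
    2 powr (real K - real n / (real M + 2)) + (if q n = 2 then 2 ^ K * (t n / \<theta> n) else 0)" for n
  have "(\<lambda>n::nat. 2 powr (real K - real n / (real M + 2))) \<longlonglongrightarrow> 0"
    by real_asymp
  then have "err \<longlonglongrightarrow> 0 + 0 + 0"
    unfolding err_def using err1 err2 by (intro tendsto_add)
  then have "(\<lambda>n. 1 / (1 + (real M + 1) * err n)) \<longlonglongrightarrow> 1 / (1 + (real M + 1) * 0)"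
    by (intro tendsto_intros) auto
  then have lim: "(\<lambda>n. 1 / (1 + (real M + 1) * err n)) \<longlonglongrightarrow> 1"
    by simp
  have "\<forall>\<^sub>F n in sequentially. n \<ge> K * (M + 2) + M"
    by (rule eventually_ge_at_top)
  with c have "\<forall>\<^sub>F n in sequentially. 1 / (1 + (real M + 1) * err n) \<le>
      prob_contains_flat (F n) n (m n) (\<theta> n)"
  proof eventually_elim
    case (elim n)
    let ?c = "\<theta> n / t n"
    have \<theta>0: "\<theta> n > 0" "\<theta> n \<le> 1"
      using elim(1) threshold_pos[of n] \<theta>[of n] by (auto simp: field_simps)
    \<comment> \<open>The summand M in the lower bound on \<open>n\<close> yields the first
      inequality and the summand K(M+2) the second.\<close>
    have mn: "m n \<le> n" "K * (M + 2) \<le> n"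
      using elim(2) m(2)[of n] by auto
    let ?T = "\<lambda>j. (real (q n) ^ m n / real (q n) ^ (n - m n)) ^ (j + 1) * (1 / \<theta> n) ^ (q n ^ j)"
    have T: "?T j \<le> err n" if "j \<le> m n" for j
    proof -
      have eq: "?c * t n = \<theta> n" "1 / ?c = t n / \<theta> n" "2 ^ K / ?c = 2 ^ K * (t n / \<theta> n)"
        using threshold_pos[of n] by auto
      show ?thesis
        using second_moment_term_le[OF q[of n] m(1) m(2) that mn(1) mn(2)[unfolded K_def] elim(1),
            folded t K_def]
        by (simp only: err_def eq)
    qed
    have T0: "?T j \<ge> 0" for j
      using \<theta>0 by simp
    have err0: "err n \<ge> 0"
      using T[of 0] T0[of 0] by linarith
    have "(\<Sum>j\<le>m n. ?T j) \<le> real (m n + 1) * err n"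
      using sum_bounded_above[of "{..m n}" ?T "err n"] T by simp
    also have "\<dots> \<le> (real M + 1) * err n"
      using m(2)[of n] err0 by (intro mult_right_mono) auto
    finally have "(\<Sum>j\<le>m n. ?T j) \<le> (real M + 1) * err n" .
    moreover have "0 \<le> (\<Sum>j\<le>m n. ?T j)"
      by (intro sum_nonneg T0)
    ultimately have "1 / (1 + (real M + 1) * err n) \<le> 1 / (1 + (\<Sum>j\<le>m n. ?T j))"
      by (intro frac_le) linarith+
    also have "\<dots> \<le> prob_contains_flat (F n) n (m n) (\<theta> n)"
      using field.prob_contains_flat_ge[OF F finite_carrier_seq mn(1) \<theta>0] by (simp add: ord)
    finally show ?case .
  qed
  then show ?thesis
  proof (rule tendsto_sandwich[OF _ _ lim tendsto_const])
    show "\<forall>\<^sub>F n in sequentially. prob_contains_flat (F n) n (m n) (\<theta> n) \<le> 1"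
      by (simp add: prob_contains_flat_def)
  qed
qed

lemma threshold_function_prob_contains_flat:
  "threshold_function (\<lambda>n. prob_contains_flat (F n) n (m n)) t"
  unfolding threshold_function_def
proof (intro allI impI conjI)
  fix \<theta> :: "nat \<Rightarrow> real" assume \<theta>: "\<forall>n. \<theta> n \<in> {0..1}"
  let ?P = "\<lambda>n. prob_contains_flat (F n) n (m n) (\<theta> n)"
  have tpos: "t n > 0" for n by (rule threshold_pos)
  {
    assume "\<theta> \<in> o(t)"
    then have lim: "(\<lambda>n. \<theta> n / t n) \<longlonglongrightarrow> 0"
      by (rule smalloD_tendsto)
    show "?P \<longlonglongrightarrow> 0"
    proof (rule tendsto_sandwich[OF _ _ tendsto_const lim])
      show "\<forall>\<^sub>F n in sequentially. 0 \<le> ?P n"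
        by (simp add: prob_contains_flat_def)
      have "\<forall>\<^sub>F n in sequentially. \<theta> n / t n < 1"
        using lim by (rule order_tendstoD) simp
      then show "\<forall>\<^sub>F n in sequentially. ?P n \<le> \<theta> n / t n"
      proof eventually_elim
        case (elim n)
        have "?P n \<le> (\<theta> n / t n) ^ (q n ^ m n)"
          using \<theta> by (intro prob_contains_flat_le_ratio_power) auto
        also have "\<dots> \<le> (\<theta> n / t n) ^ 1"
          using elim \<theta> tpos[of n] q[of n] by (intro power_decreasing) (auto simp: Suc_le_eq)
        finally show ?case by simp
      qed
    qed
  next
    assume "\<theta> \<in> \<omega>(t)"
    then have "filterlim (\<lambda>n. norm (\<theta> n / t n)) at_top sequentially"
      using tpos by (intro smallomegaD_filterlim_at_top_norm) (auto simp: less_imp_neq[symmetric])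
    then have lim: "filterlim (\<lambda>n. \<theta> n / t n) at_top sequentially"
      using \<theta> tpos by (simp add: less_imp_le)
    have inv: "(\<lambda>n. t n / \<theta> n) \<longlonglongrightarrow> 0"
      using tendsto_inverse_0_at_top[OF lim] by simp
    \<comment> \<open>As q may behave arbitrarily along the sequence, q^K has to be absorbed
      uniformly. The sequence k^K / 2^k is bounded, so half of the base of the q-th power is spent
      on it.\<close>
    define K where "K = 2 * M * (M + 1)"
    have "(\<lambda>k::nat. real k ^ K * (1 / 2) ^ k) \<longlonglongrightarrow> 0"
      by real_asymp
    then have "Bseq (\<lambda>k::nat. real k ^ K * (1 / 2) ^ k)"
      by (intro convergent_imp_Bseq convergentI)
    then obtain C where "\<forall>k. norm (real k ^ K * (1 / 2) ^ k) \<le> C"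
      by (elim BseqE)
    then have C: "real k ^ K * (1 / 2) ^ k \<le> C" for k
      by (auto intro: order_trans[OF abs_ge_self] simp del: abs_mult)
    show "?P \<longlonglongrightarrow> 1"
    proof (rule prob_contains_flat_tendsto_1)
      show "\<forall>\<^sub>F n in sequentially. 1 \<le> \<theta> n / t n"
        using lim by (auto simp: filterlim_at_top)
      show "(\<lambda>n. real (q n) ^ (2 * M * (M + 1)) * (t n / \<theta> n) ^ q n) \<longlonglongrightarrow> 0"
      proof (rule tendsto_sandwich[OF _ _ tendsto_const])
        show "\<forall>\<^sub>F n in sequentially. 0 \<le> real (q n) ^ (2 * M * (M + 1)) * (t n / \<theta> n) ^ q n"
          using \<theta> tpos by (auto simp: less_imp_le)
        show "(\<lambda>n. C * (2 * (t n / \<theta> n))) \<longlonglongrightarrow> 0"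
          using inv by (intro tendsto_mult_right_zero)
        have "\<forall>\<^sub>F n in sequentially. t n / \<theta> n < 1 / 2"
          using inv by (rule order_tendstoD) simp
        then show "\<forall>\<^sub>F n in sequentially.
            real (q n) ^ (2 * M * (M + 1)) * (t n / \<theta> n) ^ q n \<le> C * (2 * (t n / \<theta> n))"
        proof eventually_elim
          case (elim n)
          have c: "0 \<le> 2 * (t n / \<theta> n)"
            using \<theta> tpos[of n] by (auto simp: less_imp_le)
          have c': "2 * (t n / \<theta> n) \<le> 1"
            using elim by linarith
          have "real (q n) ^ K * (t n / \<theta> n) ^ q n =
              (real (q n) ^ K * (1 / 2) ^ q n) * (2 * (t n / \<theta> n)) ^ q n"
            by (simp add: mult.assoc flip: power_mult_distrib)
          also have "\<dots> \<le> C * (2 * (t n / \<theta> n)) ^ 1"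
          proof (rule mult_mono[OF C])
            show "(2 * (t n / \<theta> n)) ^ q n \<le> (2 * (t n / \<theta> n)) ^ 1"
              using c c' q[of n] by (intro power_decreasing) auto
            show "0 \<le> C"
              using C[of 0] by (rule order_trans[rotated]) simp
          qed (use c in auto)
          finally show ?case by (simp add: K_def)
        qed
      qed
      have inv': "(\<lambda>n. 2 ^ (2 * M * (M + 1)) * (t n / \<theta> n)) \<longlonglongrightarrow> 0"
        using inv by (rule tendsto_mult_right_zero)
      show "(\<lambda>n. if q n = 2 then 2 ^ (2 * M * (M + 1)) * (t n / \<theta> n) else 0) \<longlonglongrightarrow> 0"
        by (rule tendsto_sandwich[OF _ _ tendsto_const inv'])
          (use \<theta> tpos in \<open>auto simp: less_imp_le\<close>)
    qed (use \<theta> in auto)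
  }
qed

text \<open>The ratio of \<theta> to t enters with an exponent of at least q in the upper bound and
  exactly q in \<open>err1\<close>. A fixed factor 1 - \<epsilon> or 1 + \<epsilon> is thereby
  amplified without limit, in the second case faster than q^K grows.\<close>

lemma sharp_threshold_prob_contains_flat:
  assumes q_lim: "filterlim q at_top sequentially"
  shows "sharp_threshold (\<lambda>n. prob_contains_flat (F n) n (m n)) t"
  unfolding sharp_threshold_def
proof (intro allI impI conjI)
  fix \<epsilon> :: real and \<theta> :: "nat \<Rightarrow> real" assume \<epsilon>: "\<epsilon> > 0" and \<theta>: "\<forall>n. \<theta> n \<in> {0..1}"
  let ?P = "\<lambda>n. prob_contains_flat (F n) n (m n) (\<theta> n)"
  have tpos: "t n > 0" for n by (rule threshold_pos)
  {
    assume le: "\<forall>\<^sub>F n in sequentially. \<theta> n \<le> (1 - \<epsilon>) * t n"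
    \<comment> \<open>The maximum keeps the base nonnegative when \<epsilon> > 1.\<close>
    define r where "r = max 0 (1 - \<epsilon>)"
    have r: "0 \<le> r" "r < 1"
      using \<epsilon> by (auto simp: r_def)
    have lim: "(\<lambda>n. r ^ q n) \<longlonglongrightarrow> 0"
      using LIMSEQ_realpow_zero[OF r] q_lim by (rule filterlim_compose)
    show "?P \<longlonglongrightarrow> 0"
    proof (rule tendsto_sandwich[OF _ _ tendsto_const lim])
      show "\<forall>\<^sub>F n in sequentially. 0 \<le> ?P n"
        by (simp add: prob_contains_flat_def)
      show "\<forall>\<^sub>F n in sequentially. ?P n \<le> r ^ q n"
        using le
      proof eventually_elim
        case (elim n)
        have "\<theta> n / t n \<le> 1 - \<epsilon>"
          using elim tpos[of n] by (simp add: pos_divide_le_eq)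
        then have "\<theta> n / t n \<le> r"
          by (simp add: r_def)
        have "?P n \<le> (\<theta> n / t n) ^ (q n ^ m n)"
          using \<theta> by (intro prob_contains_flat_le_ratio_power) auto
        also have "\<dots> \<le> r ^ (q n ^ m n)"
          using \<open>\<theta> n / t n \<le> r\<close> \<theta> tpos[of n] by (intro power_mono) (auto simp: less_imp_le)
        also have "\<dots> \<le> r ^ q n"
          using r m(1)[of n] q[of n] self_le_power[of "q n" "m n"] by (intro power_decreasing) auto
        finally show ?case .
      qed
    qed
  next
    assume ge: "\<forall>\<^sub>F n in sequentially. \<theta> n \<ge> (1 + \<epsilon>) * t n"
    have c: "\<forall>\<^sub>F n in sequentially. 0 < t n / \<theta> n \<and> t n / \<theta> n \<le> 1 / (1 + \<epsilon>)"
      using ge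
    proof eventually_elim
      case (elim n)
      have "0 < (1 + \<epsilon>) * t n"
        using \<epsilon> tpos[of n] by simp
      then have "\<theta> n > 0"
        using elim by linarith
      then show ?case
        using elim \<epsilon> tpos[of n] by (simp add: field_simps)
    qed
    show "?P \<longlonglongrightarrow> 1"
    proof (rule prob_contains_flat_tendsto_1)
      show "\<forall>\<^sub>F n in sequentially. 1 \<le> \<theta> n / t n"
        using ge
      proof eventually_elim
        case (elim n)
        have "1 * t n \<le> (1 + \<epsilon>) * t n"
          using \<epsilon> tpos[of n] by (intro mult_right_mono) auto
        then show ?case
          using elim tpos[of n] by (simp add: field_simps)
      qed
      show "(\<lambda>n. real (q n) ^ (2 * M * (M + 1)) * (t n / \<theta> n) ^ q n) \<longlonglongrightarrow> 0"
      proof (rule tendsto_sandwich[OF _ _ tendsto_const])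
        have "(\<lambda>k::nat. real k ^ (2 * M * (M + 1)) * (1 / (1 + \<epsilon>)) ^ k) \<longlonglongrightarrow> 0"
          using \<epsilon> by real_asymp
        then show "(\<lambda>n. real (q n) ^ (2 * M * (M + 1)) * (1 / (1 + \<epsilon>)) ^ q n) \<longlonglongrightarrow> 0"
          using q_lim by (rule filterlim_compose)
        show "\<forall>\<^sub>F n in sequentially. 0 \<le> real (q n) ^ (2 * M * (M + 1)) * (t n / \<theta> n) ^ q n"
          using c by eventually_elim simp
        show "\<forall>\<^sub>F n in sequentially. real (q n) ^ (2 * M * (M + 1)) * (t n / \<theta> n) ^ q n \<le>
            real (q n) ^ (2 * M * (M + 1)) * (1 / (1 + \<epsilon>)) ^ q n"
          using c by eventually_elim (auto intro!: mult_left_mono power_mono)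
      qed
      have "\<forall>\<^sub>F n in sequentially. 3 \<le> q n"
        using q_lim by (auto simp: filterlim_at_top)
      then have "\<forall>\<^sub>F n in sequentially. 0 = (if q n = 2 then 2 ^ (2 * M * (M + 1)) * (t n / \<theta> n) else 0)"
        by eventually_elim auto
      \<comment> \<open>Once q exceeds 2 the exceptional case is over and this error term is
        eventually zero.\<close>
      then show "(\<lambda>n. if q n = 2 then 2 ^ (2 * M * (M + 1)) * (t n / \<theta> n) else 0) \<longlonglongrightarrow> 0"
        by (rule Lim_transform_eventually[OF tendsto_const])
    qed (use \<theta> in auto)
  }
qed

end

theorem theorem1p7:
  fixes F :: "nat \<Rightarrow> ('a, 'b) ring_scheme"
    and q m :: "nat \<Rightarrow> nat"
    and t :: "nat \<Rightarrow> real"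
  assumes "\<And>n. primepow (q n)"
    and "\<And>n. field (F n)"
    and "\<And>n. order (F n) = q n"
    and "\<And>n. m n > 0"
    and "\<exists>M. \<forall>n. m n \<le> M"
    and "\<And>n. t n = real (q n) powr (- (real n * (real (m n) + 1) * real (q n) powr (- real (m n))))"
  shows "threshold_function (\<lambda>n. prob_contains_flat (F n) n (m n)) t \<and>
    (filterlim q at_top sequentially \<longrightarrow>
      sharp_threshold (\<lambda>n. prob_contains_flat (F n) n (m n)) t)"
proof -
  obtain M where "\<forall>n. m n \<le> M"
    using assms(5) ..
  then have M: "m n \<le> M" for n
    by (rule spec)
  have "q n \<ge> 2" for n
    using primepow_gt_Suc_0[OF assms(1)[of n]] by linarith
  note * = this assms(2-4) M assms(6)
  show ?thesis
    by (intro conjI impI threshold_function_prob_contains_flat[OF *]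
        sharp_threshold_prob_contains_flat[OF *])
qed

end
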